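(* Let $f$ be a doubly concave function on $[0,\infty)$, let $A,B\in\mathbb{M}_n^+$ and let $0<p\le1$. Then $$f(A\,\beta_p\,B)\ge V\{f(A)\,\beta_p\,f(B)\}V^*$$ for some unitary $V\in\mathbb{M}_n$. Moreover, this holds for $p=0$ too when $f$ is not identically zero and $A,B$ are invertible.
   Context: $\mathbb{M}_n$ is the algebra of $n\times n$ complex matrices and $\mathbb{M}_n^+$ the set of its positive semidefinite matrices; $\ge$ is the Loewner order. For $p>0$ and $A,B\in\mathbb{M}_n^+$, $A\,\beta_p\,B:=\left(\frac{A^p+B^p}{2}\right)^{1/p}$; for invertible $A,B\in\mathbb{M}_n^+$, $A\,\beta_0\,B:=\lim_{p\searrow0}A\,\beta_p\,B=\exp\left(\frac{\log A+\log B}{2}\right)$. A function $f$ on an interval $\Omega\subset[0,\infty)$ is doubly concave if it is non-negative, continuous, concave, and geometrically concave, i.e. $f(\sqrt{xy})\ge\sqrt{f(x)f(y)}$ for all $x,y\in\Omega$. *)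

theory Defs
  imports "HOL-Analysis.Analysis"
begin

definition adj :: "complex^'n^'m \<Rightarrow> complex^'m^'n" where
  "adj A = (\<chi> i j. cnj (A $ j $ i))"

definition hermitian :: "complex^'n^'n \<Rightarrow> bool" where
  "hermitian A \<longleftrightarrow> adj A = A"

definition unitary :: "complex^'n^'n \<Rightarrow> bool" where
  "unitary U \<longleftrightarrow> adj U ** U = mat 1 \<and> U ** adj U = mat 1"

text \<open>On \<open>complex^'n\<close> the inner product \<open>x \<bullet> y\<close> is the real part of the usual Hermitian
  one; the quadratic form of a Hermitian matrix is real, so nothing is lost below.\<close>

definition psd :: "complex^'n^'n \<Rightarrow> bool" where
  "psd A \<longleftrightarrow> hermitian A \<and> (\<forall>x. 0 \<le> x \<bullet> (A *v x))"

definition loewner_le :: "complex^'n^'n \<Rightarrow> complex^'n^'n \<Rightarrow> bool"  (infix "\<preceq>" 50) where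
  "A \<preceq> B \<longleftrightarrow> psd (B - A)"

definition diag :: "('n \<Rightarrow> real) \<Rightarrow> complex^'n^'n" where
  "diag d = (\<chi> i j. if i = j then complex_of_real (d i) else 0)"

text \<open>Functional calculus \<open>f(A)\<close> for Hermitian \<open>A\<close>. By the lemma \<open>mat_fun_eq\<close> below, the result does
  not depend on the chosen diagonalization. Only the values of \<open>f\<close> on the spectrum of \<open>A\<close> matter.\<close>

definition mat_fun :: "(real \<Rightarrow> real) \<Rightarrow> complex^'n^'n \<Rightarrow> complex^'n^'n" where
  "mat_fun f A = (THE B. \<exists>U d. unitary U \<and> A = U ** diag d ** adj U \<and>
                              B = U ** diag (f \<circ> d) ** adj U)"

text \<open>The mean \<open>A \<beta>\<^sub>p B\<close>, meant for \<open>p > 0\<close> and positive semidefinite \<open>A\<close>, \<open>B\<close>; note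
  \<open>0 powr p = 0\<close>.\<close>

definition power_mean :: "real \<Rightarrow> complex^'n^'n \<Rightarrow> complex^'n^'n \<Rightarrow> complex^'n^'n" where
  "power_mean p A B =
     mat_fun (\<lambda>x. x powr (1 / p))
       ((1 / 2) *\<^sub>R (mat_fun (\<lambda>x. x powr p) A + mat_fun (\<lambda>x. x powr p) B))"

text \<open>The mean \<open>A \<beta>\<^sub>0 B\<close>, meant for invertible positive semidefinite \<open>A\<close>, \<open>B\<close>. The limit then
  exists and equals \<open>exp ((log A + log B) / 2)\<close>.\<close>

definition power_mean0 :: "complex^'n^'n \<Rightarrow> complex^'n^'n \<Rightarrow> complex^'n^'n" where
  "power_mean0 A B = Lim (at_right 0) (\<lambda>p. power_mean p A B)"

definition doubly_concave_on :: "real set \<Rightarrow> (real \<Rightarrow> real) \<Rightarrow> bool" where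
  "doubly_concave_on S f \<longleftrightarrow>
     is_interval S \<and> S \<subseteq> {0..} \<and>
     (\<forall>x\<in>S. 0 \<le> f x) \<and> continuous_on S f \<and> concave_on S f \<and>
     (\<forall>x\<in>S. \<forall>y\<in>S. f (sqrt (x * y)) \<ge> sqrt (f x * f y))"

lemma mat_fun_unique:
  fixes U W :: "complex^'n^'n"
  assumes U: "unitary U" and W: "unitary W"
    and eq: "U ** diag d ** adj U = W ** diag e ** adj W"
  shows "U ** diag (f \<circ> d) ** adj U = W ** diag (f \<circ> e) ** adj W"
proof -
  define X where "X = adj W ** U"
  have diag_r: "(X ** diag g) $ i $ j = X $ i $ j * complex_of_real (g j)" for g i j
    by (simp add: matrix_matrix_mult_def diag_def if_distrib cong: if_cong)
  have diag_l: "(diag g ** X) $ i $ j = complex_of_real (g i) * X $ i $ j" for g i j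
    by (simp add: matrix_matrix_mult_def diag_def if_distrib if_distribR cong: if_cong)
  have "X ** diag d = adj W ** (U ** diag d ** adj U) ** U"
    using U by (simp add: X_def unitary_def flip: matrix_mul_assoc)
  also have "\<dots> = (adj W ** W) ** diag e ** (adj W ** U)"
    unfolding eq by (simp add: matrix_mul_assoc)
  also have "\<dots> = diag e ** X"
    using W by (simp add: X_def unitary_def)
  finally have *: "X $ i $ j * complex_of_real (d j) = complex_of_real (e i) * X $ i $ j" for i j
    by (metis diag_l diag_r)
  have "X $ i $ j * complex_of_real (f (d j)) = complex_of_real (f (e i)) * X $ i $ j" for i j
    using *[of i j] by (cases "X $ i $ j = 0") auto
  then have **: "X ** diag (f \<circ> d) = diag (f \<circ> e) ** X"
    by (simp add: vec_eq_iff diag_l diag_r)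
  have "U ** diag (f \<circ> d) ** adj U = W ** (X ** diag (f \<circ> d)) ** adj U"
    using W by (simp add: X_def unitary_def matrix_mul_assoc)
  also have "\<dots> = W ** diag (f \<circ> e) ** adj W ** (U ** adj U)"
    unfolding ** by (simp add: X_def matrix_mul_assoc)
  finally show ?thesis
    using U by (simp add: unitary_def)
qed

lemma mat_fun_eq:
  assumes "unitary U" and "A = U ** diag d ** adj U"
  shows "mat_fun f A = U ** diag (f \<circ> d) ** adj U"
  unfolding mat_fun_def
proof (rule the_equality)
  show "\<exists>W e. unitary W \<and> A = W ** diag e ** adj W \<and>
              U ** diag (f \<circ> d) ** adj U = W ** diag (f \<circ> e) ** adj W"
    using assms by blast
next
  fix B
  assume "\<exists>W e. unitary W \<and> A = W ** diag e ** adj W \<and> B = W ** diag (f \<circ> e) ** adj W"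
  then show "B = U ** diag (f \<circ> d) ** adj U"
    using assms mat_fun_unique by metis
qed

end

theory Submission
  imports Defs
begin

text \<open>Loewner inequality up to a unitary conjugation is domination of eigenvalues, so the claim
  is that the eigenvalues of \<open>H = (f(A)\<^sup>p + f(B)\<^sup>p) / 2\<close> are, in a suitable order, at most
  \<open>f (t powr (1 / p)) powr p\<close>, where \<open>t\<close> runs over the eigenvalues of \<open>K = (A\<^sup>p + B\<^sup>p) / 2\<close>.

  It suffices that the graph of \<open>t \<mapsto> f (t powr (1 / p)) powr p\<close> has, at each point with \<open>t > 0\<close>, a
  supporting line of nonnegative slope. Unless \<open>f\<close> vanishes identically, it is positive on the
  positive half-line, and geometric concavity says that \<open>ln (f (exp s))\<close> is concave in \<open>s\<close>, hence \<open>f x \<le> f x\<^sub>0 (x / x\<^sub>0)\<^sup>\<theta>\<close> for some exponent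
  \<open>\<theta>\<close>; since \<open>f\<close> is also concave and nonnegative, \<open>f\<close> is nondecreasing and \<open>f x / x\<close> is nonincreasing,
  which forces \<open>0 \<le> \<theta> \<le> 1\<close>. Put \<open>v = (x / x\<^sub>0)\<^sup>p\<close>. Then the \<open>p\<close>-th power of the bound is
  \<open>f(x\<^sub>0)\<^sup>p v\<^sup>\<theta> \<le> f(x\<^sub>0)\<^sup>p (1 + \<theta> (v - 1))\<close>, which is affine in \<open>x\<^sup>p\<close>
  (\<open>doubly_concave_powr_le_affine\<close>).

  An affine bound \<open>f(x)\<^sup>p \<le> c + m x\<^sup>p\<close> with \<open>m \<ge> 0\<close> passes to the matrices as \<open>H \<le> c + m K\<close>. If
  the line is the one that touches at an eigenvalue \<open>t\<close> of \<open>K\<close>, then on the span of the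
  eigenvectors of \<open>K\<close> with eigenvalue at most \<open>t\<close> the quadratic form of \<open>H\<close> is bounded by the value of
  the function at \<open>t\<close>. Counting dimensions as in the min-max principle turns these bounds into a
  permutation that matches the eigenvalues (\<open>eigenvalues_dominated\<close>).

  For \<open>p = 0\<close> the same argument applies with \<open>ln\<close> instead of the \<open>p\<close>-th power, and there the
  concavity of \<open>ln (f (exp s))\<close> is itself the affine bound. This requires that the limit
  defining the mean is \<open>exp ((log A + log B) / 2)\<close> (\<open>power_mean0_eq_exp_mean_ln\<close>), which
  follows from a continuity property of the functional calculus, proved by compactness of the unitary
  group (\<open>tendsto_mat_fun\<close>).\<close>

section \<open>Supporting lines of doubly concave functions\<close>

lemma doubly_concave_onD:
  assumes "doubly_concave_on {0..} f"
  shows "\<And>x. 0 \<le> x \<Longrightarrow> 0 \<le> f x" and "continuous_on {0..} f" and "concave_on {0..} f"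
    and "\<And>x y. 0 \<le> x \<Longrightarrow> 0 \<le> y \<Longrightarrow> sqrt (f x * f y) \<le> f (sqrt (x * y))"
  using assms by (auto simp: doubly_concave_on_def)

text \<open>The chord from \<open>(0, f 0)\<close> to \<open>(y, f y)\<close> lies below the graph, and lowering its left end to
  the origin only lowers it: this is the monotonicity of \<open>f x / x\<close>, stated without division.\<close>

lemma nonneg_concave_slope_antimono:
  fixes f :: "real \<Rightarrow> real"
  assumes conc: "concave_on {0..} f" and nonneg: "\<And>x. 0 \<le> x \<Longrightarrow> 0 \<le> f x"
    and "0 \<le> x" "x \<le> y"
  shows "x * f y \<le> y * f x"
proof (cases "y = 0")
  case False
  then have y: "y > 0" using assms by auto
  have "(1 - x / y) * f 0 + (x / y) * f y \<le> f ((1 - x / y) *\<^sub>R 0 + (x / y) *\<^sub>R y)"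
    using assms y by (intro concave_onD[OF conc]) auto
  moreover have "0 \<le> (1 - x / y) * f 0"
    using assms y by (intro mult_nonneg_nonneg nonneg) auto
  ultimately show ?thesis
    using y by (simp add: field_simps)
qed (use assms in auto)

text \<open>If \<open>f\<close> decreased somewhere, concavity would push it below zero further to the right.\<close>

lemma nonneg_concave_mono:
  fixes f :: "real \<Rightarrow> real"
  assumes conc: "concave_on {0..} f" and nonneg: "\<And>x. 0 \<le> x \<Longrightarrow> 0 \<le> f x"
    and x: "0 \<le> x" and xy: "x \<le> y"
  shows "f x \<le> f y"
proof (rule ccontr)
  assume "\<not> ?thesis"
  then have lt: "f y < f x" by simp
  with xy have "x < y" by (cases "x = y") auto
  \<comment> \<open>The chord through \<open>x\<close> and \<open>y\<close> reaches the value \<open>- 1\<close> at \<open>z\<close>.\<close>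
  define s where "s = (f x + 1) / (f x - f y)"
  define z where "z = x + s * (y - x)"
  have s: "s \<ge> 1" using lt nonneg[of y] x xy by (simp add: s_def field_simps)
  have "0 \<le> s * (y - x)" using s xy by simp
  then have z: "z \<ge> 0" using x by (simp add: z_def)
  have "(1 - 1 / s) * f x + (1 / s) * f z \<le> f ((1 - 1 / s) *\<^sub>R x + (1 / s) *\<^sub>R z)"
    using s x z by (intro concave_onD[OF conc]) auto
  also have "(1 - 1 / s) *\<^sub>R x + (1 / s) *\<^sub>R z = y"
    using s by (simp add: z_def field_simps)
  finally have "(s - 1) * f x + f z \<le> s * f y"
    using s by (simp add: field_simps)
  then have "f z \<le> f x - s * (f x - f y)"
    by (simp add: algebra_simps)
  also have "s * (f x - f y) = f x + 1"
    using lt by (simp add: s_def)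
  finally show False
    using nonneg[OF z] by simp
qed

lemma doubly_concave_pos:
  assumes "doubly_concave_on {0..} f" and "0 \<le> z" "f z \<noteq> 0" and "0 < x"
  shows "0 < f x"
proof -
  note f = doubly_concave_onD[OF assms(1)]
  have fz: "0 < f z" using f(1)[OF assms(2)] assms(3) by simp
  show ?thesis
  proof (cases "x \<le> z")
    case True
    have "x * f z \<le> z * f x"
      by (rule nonneg_concave_slope_antimono[OF f(3,1)]) (use assms True in auto)
    moreover have "0 < x * f z" using fz assms by simp
    ultimately show ?thesis using assms(2)
      by (smt (verit) zero_less_mult_pos mult_nonneg_nonpos)
  next
    case False
    then have "f z \<le> f x"
      by (intro nonneg_concave_mono[OF f(3,1)]) (use assms in auto)
    then show ?thesis using fz by simp
  qed
qed

text \<open>Subtract the chord from \<open>h\<close>; the difference \<open>g\<close> is still midpoint concave and vanishes at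
  both ends. At a minimiser, the midpoint inequality with one end of the interval
  shows \<open>g m / 2 \<le> g m\<close>, so the minimum is nonnegative.\<close>

lemma midpoint_concave_continuous_imp_concave:
  fixes h :: "real \<Rightarrow> real"
  assumes cont: "continuous_on UNIV h"
    and mid: "\<And>s t. (h s + h t) / 2 \<le> h ((s + t) / 2)"
  shows "concave_on UNIV h"
proof (rule concave_on_linorderI)
  fix t a b :: real
  assume t: "0 < t" "t < 1" and "a < b"
  define g where "g x = h ((1 - x) * a + x * b) - ((1 - x) * h a + x * h b)" for x
  have "continuous_on {0..1} g"
    unfolding g_def by (intro continuous_intros continuous_on_compose2[OF cont]) auto
  then obtain m where m: "m \<in> {0..1}" and min: "\<And>x. x \<in> {0..1} \<Longrightarrow> g m \<le> g x"
    using continuous_attains_inf[of "{0..1}" g] by auto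
  have g_mid: "(g x + g y) / 2 \<le> g ((x + y) / 2)" for x y
  proof -
    have "h (((1 - x) * a + x * b + ((1 - y) * a + y * b)) / 2) = h ((1 - (x + y) / 2) * a + (x + y) / 2 * b)"
      by (rule arg_cong[of _ _ h]) (simp add: field_simps)
    then show ?thesis
      using mid[of "(1 - x) * a + x * b" "(1 - y) * a + y * b"]
      by (simp add: g_def field_simps)
  qed
  have "g 0 = 0" "g 1 = 0" by (auto simp: g_def)
  \<comment> \<open>Reflect the end of \<open>{0..1}\<close> that is nearer to the minimiser \<open>m\<close> in \<open>m\<close>.\<close>
  have "0 \<le> g m"
  proof (cases "m \<le> 1 / 2")
    case True
    then show ?thesis
      using g_mid[of 0 "2 * m"] min[of "2 * m"] m \<open>g 0 = 0\<close> by auto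
  next
    case False
    then have "g m \<le> g (2 * m - 1)"
      using min[of "2 * m - 1"] m by auto
    moreover have "g (2 * m - 1) / 2 \<le> g m"
      using g_mid[of 1 "2 * m - 1"] \<open>g 1 = 0\<close> by simp
    ultimately show ?thesis
      by simp
  qed
  then have "0 \<le> g t"
    using min[of t] t by simp
  then show "(1 - t) * h a + t * h b \<le> h ((1 - t) *\<^sub>R a + t *\<^sub>R b)"
    by (simp add: g_def)
qed simp

lemma doubly_concave_log_concave:
  assumes f: "doubly_concave_on {0..} f" and pos: "\<And>x. 0 < x \<Longrightarrow> 0 < f x"
  shows "concave_on UNIV (\<lambda>s. ln (f (exp s)))"
proof (rule midpoint_concave_continuous_imp_concave)
  note f = doubly_concave_onD[OF f]
  show "continuous_on UNIV (\<lambda>s. ln (f (exp s)))"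
    by (intro continuous_intros continuous_on_compose2[OF f(2)]) (auto simp: pos[THEN less_imp_neq, symmetric] less_imp_le)
  fix s t :: real
  have "sqrt (f (exp s) * f (exp t)) \<le> f (sqrt (exp s * exp t))"
    by (intro f(4)) auto
  also have "sqrt (exp s * exp t) = exp ((s + t) / 2)"
    by (rule real_sqrt_unique) (simp_all add: power2_eq_square flip: exp_add)
  finally have "ln (sqrt (f (exp s) * f (exp t))) \<le> ln (f (exp ((s + t) / 2)))"
    by (simp add: pos)
  also have "ln (sqrt (f (exp s) * f (exp t))) = (ln (f (exp s)) + ln (f (exp t))) / 2"
    using pos[of "exp s"] pos[of "exp t"] by (simp add: ln_sqrt ln_mult)
  finally show "(ln (f (exp s)) + ln (f (exp t))) / 2 \<le> ln (f (exp ((s + t) / 2)))" .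
qed

text \<open>The slope \<open>\<theta>\<close> of a supporting line of \<open>ln (f (exp s))\<close> is the elasticity \<open>x f'(x) / f(x)\<close> when
  \<open>f\<close> is differentiable. It is nonnegative because \<open>f\<close> is nondecreasing, and at most \<open>1\<close>
  because \<open>f x / x\<close> is nonincreasing.\<close>

lemma doubly_concave_exponent:
  assumes f: "doubly_concave_on {0..} f" and pos: "\<And>x. 0 < x \<Longrightarrow> 0 < f x"
  obtains \<theta> where "0 \<le> \<theta>" "\<theta> \<le> 1"
    "\<And>s. ln (f (exp s)) \<le> ln (f (exp s\<^sub>0)) + \<theta> * (s - s\<^sub>0)"
proof -
  note fD = doubly_concave_onD[OF f]
  define h where "h s = ln (f (exp s))" for s
  have "convex_on UNIV (\<lambda>s. - h s)"
    using doubly_concave_log_concave[OF f pos] by (simp add: concave_on_def h_def)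
  then obtain c where "- h s\<^sub>0 + c * (s - s\<^sub>0) \<le> - h s" for s
    using convex_le_Inf_differential[of UNIV "\<lambda>s. - h s" s\<^sub>0] by (auto simp del: minus_diff_eq)
  then have le: "h s \<le> h s\<^sub>0 + (- c) * (s - s\<^sub>0)" for s
    by (smt (verit) mult_minus_left)
  have "h s\<^sub>0 \<le> h (s\<^sub>0 + 1)"
    using nonneg_concave_mono[OF fD(3,1), of "exp s\<^sub>0" "exp (s\<^sub>0 + 1)"] by (simp add: h_def pos)
  moreover have "h s\<^sub>0 - 1 \<le> h (s\<^sub>0 - 1)"
  proof -
    have "exp (s\<^sub>0 - 1) * f (exp s\<^sub>0) \<le> exp s\<^sub>0 * f (exp (s\<^sub>0 - 1))"
      by (rule nonneg_concave_slope_antimono[OF fD(3,1)]) auto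
    then have "ln (exp (s\<^sub>0 - 1) * f (exp s\<^sub>0)) \<le> ln (exp s\<^sub>0 * f (exp (s\<^sub>0 - 1)))"
      by (simp add: pos)
    then show ?thesis
      using pos[of "exp s\<^sub>0"] pos[of "exp (s\<^sub>0 - 1)"] by (simp add: ln_mult h_def)
  qed
  ultimately have "0 \<le> - c" "- c \<le> 1"
    using le[of "s\<^sub>0 + 1"] le[of "s\<^sub>0 - 1"] by auto
  then show thesis
    using that[of "- c"] le by (simp add: h_def)
qed

lemma doubly_concave_powr_tendsto_0:
  assumes f: "doubly_concave_on {0..} f" and p: "0 < p"
  shows "((\<lambda>x. f x powr p) \<longlongrightarrow> f 0 powr p) (at_right 0)"
proof -
  have "continuous_on {0..} (\<lambda>x. f x powr p)"
    using doubly_concave_onD(1,2)[OF f] p by (intro continuous_on_powr' continuous_on_const) auto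
  then have "((\<lambda>x. f x powr p) \<longlongrightarrow> f 0 powr p) (at 0 within {0..})"
    by (simp add: continuous_on)
  then show ?thesis
    by (rule tendsto_within_subset) auto
qed

text \<open>For \<open>x > 0\<close> this is the bound \<open>f x \<le> f x\<^sub>0 (x / x\<^sub>0)\<^sup>\<theta>\<close> raised to the power \<open>p\<close>, followed by
  weighted arithmetic-geometric means, which enters as convexity of \<open>exp\<close>; the value at
  \<open>0\<close> is a limit of the others.\<close>

lemma doubly_concave_powr_le_affine_at_pos:
  assumes f: "doubly_concave_on {0..} f" and p: "0 < p" and x0: "0 < x\<^sub>0"
  obtains b where "0 \<le> b"
    "\<And>x. 0 \<le> x \<Longrightarrow> f x powr p \<le> f x\<^sub>0 powr p + b * (x powr p - x\<^sub>0 powr p)"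
proof (cases "\<forall>x\<ge>0. f x = 0")
  case True
  then show thesis using that[of 0] x0 by simp
next
  case False
  then have pos: "0 < f x" if "0 < x" for x
    using doubly_concave_pos[OF f _ _ that] by blast
  obtain \<theta> where th: "0 \<le> \<theta>" "\<theta> \<le> 1"
    and le: "\<And>s. ln (f (exp s)) \<le> ln (f (exp (ln x\<^sub>0))) + \<theta> * (s - ln x\<^sub>0)"
    using doubly_concave_exponent[OF f pos, of "ln x\<^sub>0"] by blast
  define b where "b = \<theta> * f x\<^sub>0 powr p / x\<^sub>0 powr p"
  have b: "0 \<le> b" using th by (simp add: b_def)
  have main: "f x powr p \<le> f x\<^sub>0 powr p + b * (x powr p - x\<^sub>0 powr p)" if x: "0 < x" for x
  proof -
    define u where "u = p * (ln x - ln x\<^sub>0)"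
    have "p * ln (f x) \<le> p * (ln (f x\<^sub>0) + \<theta> * (ln x - ln x\<^sub>0))"
      using le[of "ln x"] x x0 p by (intro mult_left_mono) auto
    then have "f x powr p \<le> exp (p * ln (f x\<^sub>0) + \<theta> * u)"
      using pos[OF x] by (simp add: powr_def u_def algebra_simps)
    also have "\<dots> = f x\<^sub>0 powr p * exp ((1 - \<theta>) *\<^sub>R 0 + \<theta> *\<^sub>R u)"
      using pos[OF x0] by (simp add: powr_def exp_add)
    also have "\<dots> \<le> f x\<^sub>0 powr p * ((1 - \<theta>) * exp 0 + \<theta> * exp u)"
      by (intro mult_left_mono convex_onD[OF exp_convex]) (use th in auto)
    also have "exp u = x powr p / x\<^sub>0 powr p"
      using x x0 by (simp add: powr_def u_def right_diff_distrib exp_diff)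
    also have "f x\<^sub>0 powr p * ((1 - \<theta>) * exp 0 + \<theta> * (x powr p / x\<^sub>0 powr p))
        = f x\<^sub>0 powr p + b * (x powr p - x\<^sub>0 powr p)"
      using x0 by (simp add: b_def field_simps)
    finally show ?thesis .
  qed
  note doubly_concave_powr_tendsto_0[OF f p]
  moreover have "((\<lambda>x. x powr p) \<longlongrightarrow> 0 powr p) (at_right (0::real))"
    using p by (intro tendsto_powr' tendsto_ident_at tendsto_const)
      (auto intro!: eventually_at_rightI[of 0 1])
  then have "((\<lambda>x. f x\<^sub>0 powr p + b * (x powr p - x\<^sub>0 powr p))
      \<longlongrightarrow> f x\<^sub>0 powr p + b * (0 powr p - x\<^sub>0 powr p)) (at_right 0)"
    by (intro tendsto_add tendsto_mult tendsto_diff tendsto_const)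
  moreover have "\<forall>\<^sub>F x in at_right 0. f x powr p \<le> f x\<^sub>0 powr p + b * (x powr p - x\<^sub>0 powr p)"
    by (rule eventually_at_rightI[of 0 1]) (use main in auto)
  ultimately have "f 0 powr p \<le> f x\<^sub>0 powr p + b * (0 powr p - x\<^sub>0 powr p)"
    by (intro tendsto_le) auto
  with main have "f x powr p \<le> f x\<^sub>0 powr p + b * (x powr p - x\<^sub>0 powr p)" if "0 \<le> x" for x
    using that by (cases "x = 0") auto
  then show thesis
    using that b by blast
qed

text \<open>The slack \<open>r\<close> admits the point \<open>x\<^sub>0 = 0\<close>, where the graph may have a vertical tangent, as for a
  square root: the line is then taken at a point slightly to the right.\<close>

lemma doubly_concave_powr_le_affine:
  assumes f: "doubly_concave_on {0..} f" and p: "0 < p" and x0: "0 \<le> x\<^sub>0" and r: "f x\<^sub>0 powr p < r"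
  obtains c m where "0 \<le> m" "c + m * x\<^sub>0 powr p \<le> r" "\<And>x. 0 \<le> x \<Longrightarrow> f x powr p \<le> c + m * x powr p"
proof -
  obtain t where t: "0 < t" "f t powr p < r" "x\<^sub>0 = t \<or> x\<^sub>0 = 0"
  proof (cases "x\<^sub>0 = 0")
    case True
    have "\<forall>\<^sub>F t in at_right 0. f t powr p < r"
      using doubly_concave_powr_tendsto_0[OF f p] r True by (intro order_tendstoD(2)) auto
    moreover have "\<forall>\<^sub>F t in at_right (0::real). 0 < t"
      by (rule eventually_at_right_less)
    ultimately have "\<forall>\<^sub>F t in at_right 0. 0 < t \<and> f t powr p < r"
      by eventually_elim simp
    then obtain t where "0 < t \<and> f t powr p < r"
      using eventually_happens'[OF trivial_limit_at_right_real] by blast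
    then show ?thesis
      using that[of t] True by blast
  next
    case False
    then show ?thesis
      using that[of "x\<^sub>0"] x0 r by simp
  qed
  obtain m where m: "0 \<le> m"
    and le: "\<And>s. 0 \<le> s \<Longrightarrow> f s powr p \<le> f t powr p + m * (s powr p - t powr p)"
    using doubly_concave_powr_le_affine_at_pos[OF f p t(1)] by metis
  show thesis
  proof (rule that[OF m])
    have "0 \<le> m * t powr p"
      using m by simp
    then show "(f t powr p - m * t powr p) + m * x\<^sub>0 powr p \<le> r"
      using t(2,3) by auto
    show "f x powr p \<le> (f t powr p - m * t powr p) + m * x powr p" if "0 \<le> x" for x
      using le[OF that] by (simp add: algebra_simps)
  qed
qed

section \<open>Diagonalization of Hermitian matrices\<close>

lemma adj_mult: "adj (A ** B) = adj B ** adj A"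
  by (simp add: adj_def matrix_matrix_mult_def vec_eq_iff mult.commute)

lemma adj_adj [simp]: "adj (adj A) = A"
  by (simp add: adj_def vec_eq_iff)

lemma adj_diag [simp]: "adj (diag d) = diag d"
  by (simp add: adj_def diag_def vec_eq_iff)

lemma inner_complex_cnj: "z \<bullet> w = Re (cnj z * w)"
  by (simp add: inner_complex_def)

lemma inner_adj:
  fixes A :: "complex^'n^'m"
  shows "x \<bullet> (A *v y) = (adj A *v x) \<bullet> y"
proof -
  have "x \<bullet> (A *v y) = Re (\<Sum>i\<in>UNIV. \<Sum>j\<in>UNIV. cnj (x $ i) * A $ i $ j * y $ j)"
    by (simp add: inner_vec_def inner_complex_cnj matrix_vector_mult_def
        sum_distrib_left mult.assoc)
  also have "(\<Sum>i\<in>UNIV. \<Sum>j\<in>UNIV. cnj (x $ i) * A $ i $ j * y $ j)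
      = (\<Sum>j\<in>UNIV. \<Sum>i\<in>UNIV. cnj (x $ i) * A $ i $ j * y $ j)"
    by (rule sum.swap)
  also have "\<dots> = (\<Sum>j\<in>UNIV. cnj ((adj A *v x) $ j) * y $ j)"
    by (simp add: matrix_vector_mult_def adj_def sum_distrib_right sum_distrib_left mult_ac)
  also have "Re \<dots> = (adj A *v x) \<bullet> y"
    by (simp add: inner_vec_def inner_complex_cnj)
  finally show ?thesis .
qed

lemma matrix_vector_mult_real_scale:
  fixes M :: "complex^'n^'m"
  shows "M *v (c *\<^sub>R x) = c *\<^sub>R (M *v x)"
  by (simp add: matrix_vector_mult_def vec_eq_iff scaleR_sum_right)

text \<open>This replaces dimension counting: to find a nonzero solution of fewer than \<open>n\<close> linear
  equations, write them into the rows of a square matrix and leave some row zero.\<close>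

lemma exists_kernel_vector_of_zero_row:
  fixes M :: "complex^'n^'n"
  assumes "row k M = 0"
  shows "\<exists>x. x \<noteq> 0 \<and> M *v x = 0"
proof (rule ccontr)
  assume "\<not> ?thesis"
  then obtain N where "N ** M = mat 1"
    using matrix_left_invertible_ker by blast
  then have "invertible M"
    by (metis invertible_def matrix_left_right_inverse)
  then have "det M \<noteq> 0"
    by (simp add: invertible_det_nz)
  then show False
    using assms det_zero_row(1) by blast
qed

text \<open>The vectors orthogonal to the given eigenvectors form a nonzero space that is invariant under
  \<open>A\<close>. A maximiser of the Rayleigh quotient on its unit sphere is an eigenvector. The condition
  \<open>k \<notin> S\<close> leaves room for one more eigenvector.\<close>

lemma hermitian_eigenvector_on_complement:
  fixes A :: "complex^'n^'n" and S :: "'n set"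
  assumes A: "hermitian A" and k: "k \<notin> S"
    and eig: "\<And>i. i \<in> S \<Longrightarrow> A *v v i = complex_of_real (d i) *s v i"
  shows "\<exists>x l. norm x = 1 \<and> A *v x = complex_of_real l *s x \<and>
               (\<forall>i\<in>S. (\<Sum>r\<in>UNIV. cnj (v i $ r) * x $ r) = 0)"
proof -
  define M where "M = (\<chi> i r. if i \<in> S then cnj (v i $ r) else 0)"
  define V where "V = {x. M *v x = 0}"
  have memV: "x \<in> V \<longleftrightarrow> (\<forall>i\<in>S. (\<Sum>r\<in>UNIV. cnj (v i $ r) * x $ r) = 0)" for x
  proof -
    have "(M *v x) $ i = (if i \<in> S then \<Sum>r\<in>UNIV. cnj (v i $ r) * x $ r else 0)" for i
      by (simp add: M_def matrix_vector_mult_def)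
    then show ?thesis
      by (auto simp: V_def vec_eq_iff)
  qed
  have "row k M = 0"
    using k by (simp add: row_def M_def vec_eq_iff)
  then obtain z where z: "z \<noteq> 0" "z \<in> V"
    using exists_kernel_vector_of_zero_row unfolding V_def by blast
  have V_scale: "c *\<^sub>R x \<in> V" if "x \<in> V" for c x
    using that by (simp add: V_def matrix_vector_mult_real_scale)
  have V_add: "x + y \<in> V" if "x \<in> V" "y \<in> V" for x y
    using that by (simp add: V_def matrix_vector_right_distrib)
  have V_inv: "A *v x \<in> V" if x: "x \<in> V" for x
    unfolding memV
  proof
    fix i assume i: "i \<in> S"
    have coef: "(\<Sum>r\<in>UNIV. cnj (v i $ r) * A $ r $ s) = complex_of_real (d i) * cnj (v i $ s)" for s
    proof -
      have conj: "cnj (v i $ r) * A $ r $ s = cnj (A $ s $ r * v i $ r)" for r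
      proof -
        have "A $ r $ s = adj A $ r $ s"
          using A by (simp add: hermitian_def)
        also have "\<dots> = cnj (A $ s $ r)"
          by (simp add: adj_def)
        finally show ?thesis
          by (simp only: complex_cnj_mult mult.commute)
      qed
      have "(\<Sum>r\<in>UNIV. cnj (v i $ r) * A $ r $ s) = cnj ((A *v v i) $ s)"
        by (simp only: conj matrix_vector_mult_def vec_lambda_beta cnj_sum)
      then show ?thesis
        by (simp add: eig[OF i])
    qed
    have "(\<Sum>r\<in>UNIV. cnj (v i $ r) * (A *v x) $ r)
        = (\<Sum>s\<in>UNIV. (\<Sum>r\<in>UNIV. cnj (v i $ r) * A $ r $ s) * x $ s)"
      unfolding matrix_vector_mult_def vec_lambda_beta sum_distrib_left sum_distrib_right mult.assoc
      by (rule sum.swap)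
    also have "\<dots> = complex_of_real (d i) * (\<Sum>s\<in>UNIV. cnj (v i $ s) * x $ s)"
      by (simp add: coef sum_distrib_left mult.assoc)
    also have "\<dots> = 0"
      using x i memV by simp
    finally show "(\<Sum>r\<in>UNIV. cnj (v i $ r) * (A *v x) $ r) = 0" .
  qed
  have contA: "continuous_on X (\<lambda>x. N *v x)" for X and N :: "complex^'n^'n"
    by (rule linear_continuous_on[OF matrix_vector_mul_bounded_linear])
  define K where "K = V \<inter> sphere 0 1"
  have "closed V"
    unfolding V_def by (rule closed_Collect_eq[OF contA continuous_on_const])
  then have "compact K"
    unfolding K_def by (simp add: closed_Int_compact)
  moreover have "(1 / norm z) *\<^sub>R z \<in> K"
    using z V_scale by (simp add: K_def)
  then have "K \<noteq> {}"
    by blast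
  ultimately obtain x where x: "x \<in> K" and max: "\<And>y. y \<in> K \<Longrightarrow> y \<bullet> (A *v y) \<le> x \<bullet> (A *v x)"
    using continuous_attains_sup[of K "\<lambda>x. x \<bullet> (A *v x)"] continuous_on_inner[OF continuous_on_id contA] by blast
  define l where "l = x \<bullet> (A *v x)"
  define T where "T y = l *\<^sub>R y - A *v y" for y
  have xV: "x \<in> V" and nx: "norm x = 1"
    using x by (auto simp: K_def)
  have T_add: "T (y + w) = T y + T w" and T_scale: "T (c *\<^sub>R y) = c *\<^sub>R T y" for c y w
    by (simp_all add: T_def matrix_vector_right_distrib scaleR_right_distrib
        matrix_vector_mult_real_scale scaleR_right_diff_distrib)
  have T_sym: "y \<bullet> T w = T y \<bullet> w" for y w
    using inner_adj[of y A w] A by (simp add: T_def hermitian_def inner_diff_left inner_diff_right)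
  have T_pos: "0 \<le> y \<bullet> T y" if y: "y \<in> V" for y
  proof (cases "y = 0")
    case False
    then have "(1 / norm y) *\<^sub>R y \<in> K"
      using y V_scale by (simp add: K_def)
    then have "(1 / norm y)\<^sup>2 * (y \<bullet> (A *v y)) \<le> l"
      using max[of "(1 / norm y) *\<^sub>R y"]
      by (simp add: matrix_vector_mult_real_scale l_def power2_eq_square)
    then show ?thesis
      using False by (simp add: T_def inner_diff_right field_simps dot_square_norm)
  qed (simp add: T_def)
  have xTx: "x \<bullet> T x = 0"
    using nx by (simp add: T_def inner_diff_right dot_square_norm l_def)
  have TxV: "T x \<in> V"
    using V_add[OF V_scale[OF xV, of l] V_scale[OF V_inv[OF xV], of "-1"]] by (simp add: T_def)
  \<comment> \<open>A nonnegative quadratic form that vanishes at \<open>x\<close> has \<open>x\<close> in its kernel: expand it at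
    \<open>x - t T x\<close> for small \<open>t > 0\<close>.\<close>
  have "T x \<bullet> T x \<le> 0"
  proof (rule ccontr)
    assume "\<not> ?thesis"
    then have pos: "0 < T x \<bullet> T x" by linarith
    define c where "c = \<bar>T x \<bullet> T (T x)\<bar> + 1"
    define t where "t = (T x \<bullet> T x) / c"
    have c: "c > 0" by (simp add: c_def)
    then have t: "t > 0" using pos by (simp add: t_def)
    have "0 \<le> (x + (- t) *\<^sub>R T x) \<bullet> T (x + (- t) *\<^sub>R T x)"
      by (intro T_pos V_add V_scale xV TxV)
    also have "\<dots> = - 2 * t * (T x \<bullet> T x) + t\<^sup>2 * (T x \<bullet> T (T x))"
      using xTx T_sym[of x "T x"]
      by (simp add: T_add T_scale inner_add_left inner_add_right power2_eq_square inner_commute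
          del: scaleR_minus_left)
    also have "\<dots> \<le> - 2 * t * (T x \<bullet> T x) + t\<^sup>2 * c"
      by (intro add_left_mono mult_left_mono) (auto simp: c_def)
    also have "t\<^sup>2 * c = t * (T x \<bullet> T x)"
      using c by (simp add: t_def power2_eq_square)
    finally have "t * (T x \<bullet> T x) \<le> 0"
      by simp
    with mult_pos_pos[OF t pos] show False
      by linarith
  qed
  then have "T x = 0"
    by (metis inner_ge_zero inner_eq_zero_iff order_antisym)
  then have "A *v x = complex_of_real l *s x"
    by (simp add: T_def vec_eq_iff) (simp add: scaleR_conv_of_real)
  then show ?thesis
    using nx xV memV by blast
qed

lemma hermitian_orthonormal_eigenvectors:
  fixes A :: "complex^'n^'n" and S :: "'n set"
  assumes A: "hermitian A"
  shows "\<exists>(v :: 'n \<Rightarrow> complex^'n) d. (\<forall>i\<in>S. A *v v i = complex_of_real (d i) *s v i) \<and>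
           (\<forall>i\<in>S. \<forall>j\<in>S. (\<Sum>r\<in>UNIV. cnj (v i $ r) * v j $ r) = (if i = j then 1 else 0))"
proof -
  have "finite S" by simp
  then show ?thesis
  proof induction
    case (insert k S)
    then obtain v d where eig: "\<And>i. i \<in> S \<Longrightarrow> A *v v i = complex_of_real (d i) *s v i"
      and on: "\<And>i j. i \<in> S \<Longrightarrow> j \<in> S \<Longrightarrow>
        (\<Sum>r\<in>UNIV. cnj (v i $ r) * v j $ r) = (if i = j then 1 else 0)"
      by blast
    obtain x l where x: "norm x = 1" "A *v x = complex_of_real l *s x"
      and orth: "\<And>i. i \<in> S \<Longrightarrow> (\<Sum>r\<in>UNIV. cnj (v i $ r) * x $ r) = 0"
      using hermitian_eigenvector_on_complement[of A k S v d] A insert.hyps(2) eig by metis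
    have orth': "(\<Sum>r\<in>UNIV. cnj (x $ r) * v i $ r) = 0" if "i \<in> S" for i
      using arg_cong[OF orth[OF that], of cnj] by (simp add: mult.commute)
    have "(\<Sum>r\<in>UNIV. cnj (x $ r) * x $ r) = complex_of_real ((norm x)\<^sup>2)"
      by (simp add: norm_vec_def L2_set_def sum_nonneg mult.commute
          flip: complex_norm_square)
    then have xx: "(\<Sum>r\<in>UNIV. cnj (x $ r) * x $ r) = 1"
      by (simp add: x)
    have "A *v (v(k := x)) i = complex_of_real ((d(k := l)) i) *s (v(k := x)) i"
      if "i \<in> insert k S" for i
      using that eig[of i] x(2) by (cases "i = k") simp_all
    moreover have "(\<Sum>r\<in>UNIV. cnj ((v(k := x)) i $ r) * (v(k := x)) j $ r) = (if i = j then 1 else 0)"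
      if "i \<in> insert k S" "j \<in> insert k S" for i j
      using that on[of i j] orth[of i] orth'[of j] xx by (cases "i = k"; cases "j = k") simp_all
    ultimately show ?case
      by (intro exI[of _ "v(k := x)"] exI[of _ "d(k := l)"] conjI ballI)
  qed simp
qed

theorem hermitian_diagonalization:
  fixes A :: "complex^'n^'n"
  assumes "hermitian A"
  obtains U d where "unitary U" "A = U ** diag d ** adj U"
proof -
  obtain v :: "'n \<Rightarrow> complex^'n" and d where eig: "\<And>i. A *v v i = complex_of_real (d i) *s v i"
    and on: "\<And>i j. (\<Sum>r\<in>UNIV. cnj (v i $ r) * v j $ r) = (if i = j then 1 else 0)"
    using hermitian_orthonormal_eigenvectors[OF assms, of UNIV] by blast
  define U :: "complex^'n^'n" where "U = (\<chi> r i. v i $ r)"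
  have "adj U ** U = mat 1"
    using on by (simp add: U_def adj_def matrix_matrix_mult_def mat_def vec_eq_iff)
  then have U: "unitary U"
    by (simp add: unitary_def matrix_left_right_inverse)
  have "(A ** U) $ r $ i = (U ** diag d) $ r $ i" for r i
    using arg_cong[OF eig[of i], of "\<lambda>x. x $ r"]
    by (simp add: U_def diag_def matrix_matrix_mult_def matrix_vector_mult_def if_distrib
        mult.commute cong: if_cong)
  then have "A ** U = U ** diag d"
    by (simp add: vec_eq_iff)
  then have "A ** (U ** adj U) = U ** diag d ** adj U"
    by (simp add: matrix_mul_assoc)
  then have "A = U ** diag d ** adj U"
    using U by (simp add: unitary_def flip: matrix_mul_assoc)
  then show thesis
    using that U by blast
qed

lemma matrix_mult_diff_right:
  fixes A :: "complex^'n^'m" and B C :: "complex^'k^'n"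
  shows "A ** (B - C) = A ** B - A ** C"
  by (simp add: matrix_matrix_mult_def vec_eq_iff right_diff_distrib sum_subtractf)

lemma matrix_mult_diff_left:
  fixes A B :: "complex^'n^'m" and C :: "complex^'k^'n"
  shows "(A - B) ** C = A ** C - B ** C"
  by (simp add: matrix_matrix_mult_def vec_eq_iff left_diff_distrib sum_subtractf)

lemma unitaryD:
  assumes "unitary U"
  shows "adj U ** U = mat 1" "U ** adj U = mat 1"
  using assms by (auto simp: unitary_def)

lemma unitary_mult:
  assumes "unitary U" "unitary V"
  shows "unitary (U ** V)"
proof -
  have "adj V ** (adj U ** U) ** V = mat 1" "U ** (V ** adj V) ** adj U = mat 1"
    using assms by (simp_all add: unitaryD)
  then show ?thesis
    by (simp add: unitary_def adj_mult matrix_mul_assoc)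
qed

lemma unitary_adj: "unitary U \<Longrightarrow> unitary (adj U)"
  by (simp add: unitary_def)

lemma diag_mult_vec: "(diag d *v x) $ i = complex_of_real (d i) * x $ i"
  by (simp add: matrix_vector_mult_def diag_def if_distrib if_distribR cong: if_cong)

lemma inner_diag_mult_vec:
  "x \<bullet> ((U ** diag d ** adj U) *v x) = (\<Sum>i\<in>UNIV. d i * (cmod ((adj U *v x) $ i))\<^sup>2)"
proof -
  let ?y = "adj U *v x"
  have "x \<bullet> ((U ** diag d ** adj U) *v x) = ?y \<bullet> (diag d *v ?y)"
    by (simp add: inner_adj flip: matrix_vector_mul_assoc)
  also have "\<dots> = (\<Sum>i\<in>UNIV. d i * (cmod (?y $ i))\<^sup>2)"
    by (simp add: inner_vec_def diag_mult_vec flip: scaleR_conv_of_real power2_norm_eq_inner)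
  finally show ?thesis .
qed

lemma inner_self_unitary:
  assumes "unitary U"
  shows "x \<bullet> x = (\<Sum>i\<in>UNIV. (cmod ((adj U *v x) $ i))\<^sup>2)"
proof -
  have "x \<bullet> x = (adj U *v x) \<bullet> (adj U *v x)"
    using inner_adj[of "adj U *v x" "adj U" x] assms
    by (simp add: matrix_vector_mul_assoc unitaryD)
  also have "\<dots> = (\<Sum>i\<in>UNIV. (cmod ((adj U *v x) $ i))\<^sup>2)"
    by (simp add: inner_vec_def power2_norm_eq_inner)
  finally show ?thesis .
qed

lemma hermitian_unitary_diag: "hermitian (U ** diag d ** adj U)"
  by (simp add: hermitian_def adj_mult matrix_mul_assoc)

lemma psd_unitary_diag:
  assumes "\<And>i. 0 \<le> d i"
  shows "psd (U ** diag d ** adj U)"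
  using assms by (simp add: psd_def hermitian_unitary_diag inner_diag_mult_vec sum_nonneg)

lemma unitary_diag_column:
  assumes "unitary U"
  shows "adj U *v (U *v axis i 1) = axis i 1"
  using assms by (simp add: matrix_vector_mul_assoc unitaryD)

lemma psd_diagonalization:
  assumes "psd A"
  obtains U d where "unitary U" "A = U ** diag d ** adj U" "\<And>i. 0 \<le> d i"
proof -
  obtain U d where U: "unitary U" "A = U ** diag d ** adj U"
    using assms hermitian_diagonalization unfolding psd_def by blast
  have "0 \<le> d i" for i
  proof -
    have "0 \<le> (U *v axis i 1) \<bullet> (A *v (U *v axis i 1))"
      using assms by (simp add: psd_def)
    also have "\<dots> = (\<Sum>j\<in>UNIV. d j * (cmod (axis i (1::complex) $ j))\<^sup>2)"
      by (simp add: U(2) inner_diag_mult_vec unitary_diag_column[OF U(1)])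
    also have "\<dots> = d i"
      by (simp add: axis_def if_distrib if_distribR cong: if_cong)
    finally show ?thesis .
  qed
  then show thesis
    using that U by blast
qed

lemma pos_def_diagonalization:
  assumes "psd A" "invertible A"
  obtains U d where "unitary U" "A = U ** diag d ** adj U" "\<And>i. 0 < d i"
proof -
  obtain U d where U: "unitary U" "A = U ** diag d ** adj U" and d: "\<And>i. 0 \<le> d i"
    using psd_diagonalization[OF assms(1)] by blast
  have "d i \<noteq> 0" for i
  proof
    assume "d i = 0"
    then have "diag d *v (axis i 1 :: complex^'a) = 0"
      by (simp add: vec_eq_iff diag_mult_vec axis_def)
    then have "A *v (U *v axis i 1) = 0"
      by (simp add: U(2) unitary_diag_column[OF U(1)] flip: matrix_vector_mul_assoc)
    then have "U *v axis i 1 = 0"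
      using assms(2) by (metis invertible_def matrix_left_invertible_ker)
    then have "axis i (1::complex) = (0 :: complex^'a)"
      using unitary_diag_column[OF U(1), of i] by simp
    then show False
      by simp
  qed
  then have "0 < d i" for i
    using d[of i] by (simp add: less_le)
  then show thesis
    using that U by blast
qed

lemma inner_midpoint_mult_vec:
  fixes A B :: "complex^'n^'n"
  shows "x \<bullet> (((1 / 2 :: real) *\<^sub>R (A + B)) *v x) = (x \<bullet> (A *v x) + x \<bullet> (B *v x)) / 2"
proof -
  have "((1 / 2 :: real) *\<^sub>R (A + B)) *v x = (1 / 2 :: real) *\<^sub>R (A *v x + B *v x)"
    by (simp add: matrix_vector_mult_def vec_eq_iff scaleR_sum_right distrib_right sum.distrib
        scaleR_add_right)
  then show ?thesis
    by (simp add: inner_add_right)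
qed

lemma hermitian_midpoint:
  assumes "hermitian A" "hermitian B"
  shows "hermitian ((1 / 2 :: real) *\<^sub>R (A + B))"
  using assms by (simp add: hermitian_def adj_def vec_eq_iff)

lemma psd_midpoint:
  assumes "psd A" "psd B"
  shows "psd ((1 / 2 :: real) *\<^sub>R (A + B))"
  using assms by (simp add: psd_def hermitian_midpoint inner_midpoint_mult_vec)

lemma mat_fun_comp:
  assumes "unitary U"
  shows "mat_fun g (mat_fun f (U ** diag d ** adj U)) = mat_fun (g \<circ> f) (U ** diag d ** adj U)"
  using assms by (simp add: mat_fun_eq comp_assoc)

section \<open>Domination of eigenvalues\<close>

text \<open>Two coordinate conditions with fewer than \<open>n\<close> equations altogether. An injection \<open>\<pi>\<close> places the
  rows of \<open>Q\<close> that are needed on row indices which \<open>P\<close> leaves free, and one index of \<open>J\<close> remains.\<close>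

lemma exists_nonzero_in_coordinate_intersection:
  fixes P Q :: "complex^'n^'n"
  assumes "card (- I) < card J"
  shows "\<exists>x. x \<noteq> 0 \<and> (\<forall>i\<in>-J. (P *v x) $ i = 0) \<and> (\<forall>j\<in>-I. (Q *v x) $ j = 0)"
proof -
  obtain \<pi> where pi: "inj_on \<pi> (- I)" "\<pi> ` (- I) \<subseteq> J"
    using card_le_inj[of "- I" J] assms by auto
  have "card (\<pi> ` (- I)) < card J"
    using assms card_image_le[of "- I" \<pi>] by simp
  then obtain k where k: "k \<in> J" "k \<notin> \<pi> ` (- I)"
    by (metis card_mono finite not_le subsetI)
  define M :: "complex^'n^'n" where
    "M = (\<chi> r. if r \<in> - J then P $ r
               else if r \<in> \<pi> ` (- I) then Q $ (inv_into (- I) \<pi> r) else 0)"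
  have "row k M = 0"
    using k by (simp add: row_def M_def vec_eq_iff)
  then obtain x where x: "x \<noteq> 0" "M *v x = 0"
    using exists_kernel_vector_of_zero_row by blast
  have "(P *v x) $ i = 0" if "i \<in> - J" for i
  proof -
    have "(M *v x) $ i = (P *v x) $ i"
      using that by (simp add: M_def matrix_vector_mult_def)
    then show ?thesis
      using x(2) by simp
  qed
  moreover have "(Q *v x) $ j = 0" if "j \<in> - I" for j
  proof -
    have "(M *v x) $ \<pi> j = (Q *v x) $ j"
      using that pi by (auto simp: M_def matrix_vector_mult_def)
    then show ?thesis
      using x(2) by simp
  qed
  ultimately show ?thesis
    using x(1) by blast
qed

lemma antitone_enumeration:
  fixes d :: "'n::finite \<Rightarrow> real"
  obtains s where "bij_betw s {..<CARD('n)} UNIV"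
    "\<And>i j. i \<le> j \<Longrightarrow> j < CARD('n) \<Longrightarrow> d (s j) \<le> d (s i)"
proof -
  define xs where "xs = sort_key (\<lambda>i. - d i) (SOME l. distinct l \<and> set l = UNIV)"
  have "\<exists>l::'n list. distinct l \<and> set l = UNIV"
    using finite_distinct_list[of "UNIV :: 'n set"] by auto
  then have "distinct (SOME l. distinct l \<and> set l = (UNIV :: 'n set)) \<and> set (SOME l. distinct l \<and> set l = (UNIV :: 'n set)) = UNIV"
    by (rule someI_ex)
  then have xs: "distinct xs" "set xs = UNIV"
    by (simp_all add: xs_def)
  then have len: "length xs = CARD('n)"
    using distinct_card by metis
  show thesis
  proof
    show "bij_betw ((!) xs) {..<CARD('n)} UNIV"
      using bij_betw_nth[OF xs(1), of "{..<CARD('n)}" UNIV] xs(2) len by simp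
    fix i j assume ij: "i \<le> j" "j < CARD('n)"
    have "sorted (map (\<lambda>i. - d i) xs)"
      by (simp add: xs_def)
    then show "d (xs ! j) \<le> d (xs ! i)"
      using sorted_nth_mono[of "map (\<lambda>i. - d i) xs" i j] ij len by simp
  qed
qed

text \<open>Sort both families in decreasing order and match them. If the \<open>m\<close>-th entries were in the wrong
  order, the threshold \<open>t = e (r m)\<close> would be exceeded by at least \<open>m + 1\<close> values of \<open>d\<close> but by at
  most \<open>m\<close> values of \<open>e\<close>, as positions count from \<open>0\<close>.\<close>

lemma permutation_dominating_of_card:
  fixes d e :: "'n::finite \<Rightarrow> real"
  assumes card: "\<And>t. card {i. t < d i} \<le> card {j. t < e j}"
  obtains \<sigma> where "bij \<sigma>" "\<And>i. d i \<le> e (\<sigma> i)"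
proof -
  let ?N = "{..<CARD('n)}"
  obtain s where s: "bij_betw s ?N UNIV" "\<And>i j. i \<le> j \<Longrightarrow> j < CARD('n) \<Longrightarrow> d (s j) \<le> d (s i)"
    using antitone_enumeration by blast
  obtain r where r: "bij_betw r ?N UNIV" "\<And>i j. i \<le> j \<Longrightarrow> j < CARD('n) \<Longrightarrow> e (r j) \<le> e (r i)"
    using antitone_enumeration by blast
  have le: "d (s m) \<le> e (r m)" if m: "m < CARD('n)" for m
  proof (rule ccontr)
    assume "\<not> ?thesis"
    then have lt: "e (r m) < d (s m)" by simp
    have inj: "inj_on s {..m}"
      by (rule inj_on_subset[OF bij_betw_imp_inj_on[OF s(1)]]) (use m in auto)
    have "s ` {..m} \<subseteq> {i. e (r m) < d i}"
    proof
      fix i assume "i \<in> s ` {..m}"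
      then obtain l where "l \<le> m" "i = s l"
        by blast
      then show "i \<in> {i. e (r m) < d i}"
        using s(2)[of l m] m lt by simp
    qed
    then have "card (s ` {..m}) \<le> card {i. e (r m) < d i}"
      by (intro card_mono) auto
    then have lower: "Suc m \<le> card {i. e (r m) < d i}"
      using inj by (simp add: card_image)
    have "{j. e (r m) < e j} \<subseteq> r ` {..<m}"
    proof
      fix j assume j: "j \<in> {j. e (r m) < e j}"
      obtain l where l: "l < CARD('n)" "j = r l"
        using bij_betw_imp_surj_on[OF r(1)] by blast
      have "l < m"
        using r(2)[of m l] l j by (cases "l < m") auto
      then show "j \<in> r ` {..<m}"
        using l by blast
    qed
    then have "card {j. e (r m) < e j} \<le> card (r ` {..<m})"
      by (intro card_mono) auto
    also have "\<dots> \<le> m"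
      using card_image_le[of "{..<m}" r] by simp
    finally show False
      using lower card[of "e (r m)"] by simp
  qed
  let ?q = "inv_into ?N s"
  have q: "bij_betw ?q UNIV ?N"
    by (rule bij_betw_inv_into[OF s(1)])
  show thesis
  proof
    show "bij (r \<circ> ?q)"
      by (rule bij_betw_trans[OF q r(1)])
    fix i
    have "?q i < CARD('n)" "s (?q i) = i"
      using bij_betwE[OF q] bij_betw_inv_into_right[OF s(1), of i] by auto
    then show "d i \<le> e ((r \<circ> ?q) i)"
      using le[of "?q i"] by simp
  qed
qed

text \<open>Write \<open>H\<close> and \<open>K\<close> for the two diagonalized matrices. If \<open>H\<close> had more eigenvalues above \<open>t\<close> than
  there are values \<open>e j\<close> above \<open>t\<close>, some nonzero \<open>x\<close> would lie both in the span of
  the eigenvectors of \<open>H\<close> with eigenvalue above \<open>t\<close> and in the span of the eigenvectors of \<open>K\<close>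
  whose index satisfies \<open>e j \<le> t\<close>. The bound at the index of the latter kind with the
  largest \<open>k j\<close> then gives a quadratic form of \<open>H\<close> at \<open>x\<close> of at most
  \<open>t (x \<bullet> x)\<close>, whereas it exceeds this number. The slope \<open>b \<ge> 0\<close> is what allows the
  largest \<open>k j\<close> to stand for all of them.\<close>

lemma eigenvalues_dominated:
  fixes U W :: "complex^'n^'n"
  assumes U: "unitary U" and W: "unitary W"
    and bound: "\<And>j c. e j < c \<Longrightarrow> \<exists>a b. 0 \<le> b \<and> a + b * k j \<le> c \<and>
        (\<forall>x. x \<bullet> ((U ** diag d ** adj U) *v x)
              \<le> a * (x \<bullet> x) + b * (x \<bullet> ((W ** diag k ** adj W) *v x)))"
  obtains \<sigma> where "bij \<sigma>" "\<And>i. d i \<le> e (\<sigma> i)"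
proof (rule permutation_dominating_of_card)
  let ?H = "U ** diag d ** adj U" and ?K = "W ** diag k ** adj W"
  fix t
  show "card {i. t < d i} \<le> card {j. t < e j}"
  proof (rule ccontr)
    assume "\<not> ?thesis"
    then obtain x where x: "x \<noteq> 0"
      and xd: "\<And>i. \<not> t < d i \<Longrightarrow> (adj U *v x) $ i = 0"
      and xe: "\<And>j. t < e j \<Longrightarrow> (adj W *v x) $ j = 0"
      using exists_nonzero_in_coordinate_intersection[of "- {j. t < e j}" "{i. t < d i}" "adj U" "adj W"]
      by auto
    have xx: "0 < x \<bullet> x" using x by simp
    define J where "J = {j. e j \<le> t}"
    have xx_W: "x \<bullet> x = (\<Sum>j\<in>UNIV. (cmod ((adj W *v x) $ j))\<^sup>2)"
      by (rule inner_self_unitary[OF W])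
    have "J \<noteq> {}"
    proof
      assume "J = {}"
      then have "(adj W *v x) $ j = 0" for j
        using xe[of j] by (cases "t < e j") (auto simp: J_def not_le)
      then show False
        using xx xx_W by simp
    qed
    then have "Max (k ` J) \<in> k ` J"
      by (intro Max_in) auto
    then obtain j0 where j0: "j0 \<in> J" and "Max (k ` J) = k j0"
      by blast
    then have max: "\<And>j. j \<in> J \<Longrightarrow> k j \<le> k j0"
      by (metis Max_ge finite finite_imageI imageI)
    have "x \<bullet> (?K *v x) \<le> (\<Sum>j\<in>UNIV. k j0 * (cmod ((adj W *v x) $ j))\<^sup>2)"
      unfolding inner_diag_mult_vec
    proof (rule sum_mono)
      fix j
      show "k j * (cmod ((adj W *v x) $ j))\<^sup>2 \<le> k j0 * (cmod ((adj W *v x) $ j))\<^sup>2"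
        using max[of j] xe[of j] by (cases "j \<in> J") (auto simp: J_def mult_right_mono)
    qed
    then have K_le: "x \<bullet> (?K *v x) \<le> k j0 * (x \<bullet> x)"
      by (simp add: xx_W sum_distrib_left)
    have "(x \<bullet> (?H *v x)) / (x \<bullet> x) \<le> c" if lt: "e j0 < c" for c
    proof -
      obtain a b where ab: "0 \<le> b" "a + b * k j0 \<le> c"
        and H: "x \<bullet> (?H *v x) \<le> a * (x \<bullet> x) + b * (x \<bullet> (?K *v x))"
        using bound[OF lt] by blast
      have "b * (x \<bullet> (?K *v x)) \<le> b * (k j0 * (x \<bullet> x))"
        using ab(1) K_le by (rule mult_left_mono[rotated])
      then have "x \<bullet> (?H *v x) \<le> (a + b * k j0) * (x \<bullet> x)"
        using H by (simp add: distrib_right mult.assoc)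
      also have "\<dots> \<le> c * (x \<bullet> x)"
        using ab(2) by (rule mult_right_mono) simp
      finally show ?thesis
        using xx by (simp only: divide_le_eq) simp
    qed
    then have "(x \<bullet> (?H *v x)) / (x \<bullet> x) \<le> e j0"
      by (rule dense_ge)
    also have "\<dots> \<le> t"
      using j0 by (simp add: J_def)
    finally have H_le: "x \<bullet> (?H *v x) \<le> t * (x \<bullet> x)"
      using xx by (simp add: divide_le_eq)
    have "0 < (\<Sum>i\<in>UNIV. (d i - t) * (cmod ((adj U *v x) $ i))\<^sup>2)"
    proof -
      have nn: "0 \<le> (d i - t) * (cmod ((adj U *v x) $ i))\<^sup>2" for i
        using xd[of i] by (cases "t < d i") auto
      obtain i where i: "(adj U *v x) $ i \<noteq> 0"
        using inner_self_unitary[OF U, of x] xx by force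
      then have "0 < (d i - t) * (cmod ((adj U *v x) $ i))\<^sup>2"
        using xd[of i] by (cases "t < d i") simp_all
      then show ?thesis
        by (intro sum_pos2[where i = i] nn) simp_all
    qed
    also have "\<dots> = x \<bullet> (?H *v x) - t * (x \<bullet> x)"
      unfolding inner_diag_mult_vec inner_self_unitary[OF U, of x]
      by (simp add: left_diff_distrib sum_subtractf sum_distrib_left)
    finally show False
      using H_le by simp
  qed
qed (rule that)

definition perm_mat :: "('n \<Rightarrow> 'n) \<Rightarrow> complex^'n^'n" where
  "perm_mat \<sigma> = (\<chi> i j. if i = \<sigma> j then 1 else 0)"

lemma unitary_perm_mat:
  fixes \<sigma> :: "'n::finite \<Rightarrow> 'n"
  assumes "bij \<sigma>"
  shows "unitary (perm_mat \<sigma> :: complex^'n^'n)"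
proof -
  have "(adj (perm_mat \<sigma>) ** perm_mat \<sigma>) $ i $ j = (mat 1 :: complex^'n^'n) $ i $ j" for i j
  proof -
    have "(adj (perm_mat \<sigma>) ** perm_mat \<sigma>) $ i $ j
        = (\<Sum>l\<in>UNIV. if l = \<sigma> j then if \<sigma> i = \<sigma> j then 1 else 0 else 0)"
      unfolding perm_mat_def adj_def matrix_matrix_mult_def vec_lambda_beta
      by (rule sum.cong) auto
    then show ?thesis
      using bij_is_inj[OF assms] by (simp add: mat_def inj_eq)
  qed
  then have "adj (perm_mat \<sigma>) ** perm_mat \<sigma> = (mat 1 :: complex^'n^'n)"
    unfolding vec_eq_iff by blast
  then show ?thesis
    by (simp add: unitary_def matrix_left_right_inverse)
qed

lemma mult_diag_nth: "(X ** diag g) $ i $ j = X $ i $ j * complex_of_real (g j)"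
  by (simp add: matrix_matrix_mult_def diag_def if_distrib cong: if_cong)

lemma diag_mult_nth: "(diag g ** X) $ i $ j = complex_of_real (g i) * X $ i $ j"
  by (simp add: matrix_matrix_mult_def diag_def if_distrib if_distribR cong: if_cong)

lemma diag_mult_perm_mat: "diag e ** perm_mat \<sigma> = perm_mat \<sigma> ** diag (e \<circ> \<sigma>)"
  unfolding vec_eq_iff mult_diag_nth diag_mult_nth by (simp add: perm_mat_def)

text \<open>Conjugation by \<open>W P adj U\<close>, with \<open>P\<close> the permutation matrix, makes both matrices diagonal in
  one basis, where the order is entrywise.\<close>

lemma loewner_le_of_permuted_eigenvalues:
  fixes U W :: "complex^'n^'n"
  assumes U: "unitary U" and W: "unitary W" and \<sigma>: "bij \<sigma>" and le: "\<And>i. d i \<le> e (\<sigma> i)"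
  shows "\<exists>V. unitary V \<and> V ** (U ** diag d ** adj U) ** adj V \<preceq> W ** diag e ** adj W"
proof -
  let ?P = "perm_mat \<sigma> :: complex^'n^'n"
  let ?V = "W ** ?P ** adj U"
  have P: "unitary ?P" by (rule unitary_perm_mat[OF \<sigma>])
  have V: "unitary ?V"
    by (intro unitary_mult unitary_adj U W P)
  have "?V ** (U ** diag d ** adj U) ** adj ?V
      = W ** ?P ** (adj U ** U) ** diag d ** (adj U ** U) ** adj ?P ** adj W"
    by (simp add: adj_mult matrix_mul_assoc)
  then have H: "?V ** (U ** diag d ** adj U) ** adj ?V = (W ** ?P) ** diag d ** adj (W ** ?P)"
    using U by (simp add: unitaryD adj_mult matrix_mul_assoc)
  have "W ** diag e ** adj W = W ** diag e ** (?P ** adj ?P) ** adj W"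
    using P by (simp add: unitaryD)
  also have "\<dots> = W ** (diag e ** ?P) ** adj ?P ** adj W"
    by (simp add: matrix_mul_assoc)
  also have "\<dots> = (W ** ?P) ** diag (e \<circ> \<sigma>) ** adj (W ** ?P)"
    unfolding diag_mult_perm_mat by (simp add: adj_mult matrix_mul_assoc)
  finally have "W ** diag e ** adj W - ?V ** (U ** diag d ** adj U) ** adj ?V
      = (W ** ?P) ** (diag (e \<circ> \<sigma>) - diag d) ** adj (W ** ?P)"
    by (simp add: H matrix_mult_diff_right matrix_mult_diff_left)
  also have "diag (e \<circ> \<sigma>) - diag d = diag (\<lambda>i. e (\<sigma> i) - d i)"
    by (simp add: diag_def vec_eq_iff)
  also have "psd ((W ** ?P) ** diag (\<lambda>i. e (\<sigma> i) - d i) ** adj (W ** ?P))"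
    by (rule psd_unitary_diag) (simp add: le)
  finally show ?thesis
    using V unfolding loewner_le_def by blast
qed

section \<open>The limit of the power means at zero\<close>

lemma compact_unitary: "compact {U :: complex^'n^'n. unitary U}"
proof -
  have eq: "{U :: complex^'n^'n. unitary U} = {U. adj U ** U = mat 1}"
    by (auto simp: unitary_def matrix_left_right_inverse)
  have "closed {U :: complex^'n^'n. adj U ** U = mat 1}"
    by (rule closed_Collect_eq)
      (auto simp: adj_def matrix_matrix_mult_def intro!: continuous_intros)
  moreover have "norm U \<le> (\<Sum>i\<in>(UNIV :: 'n set). \<Sum>j\<in>(UNIV :: 'n set). 1)"
    if "adj U ** U = mat 1" for U :: "complex^'n^'n"
  proof -
    have "cmod (U $ i $ j) \<le> 1" for i j
    proof -
      have "(\<Sum>l\<in>UNIV. cnj (U $ l $ j) * U $ l $ j) = 1"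
        using arg_cong[OF that, of "\<lambda>M. M $ j $ j"]
        by (simp add: adj_def matrix_matrix_mult_def mat_def)
      then have "complex_of_real (\<Sum>l\<in>UNIV. (cmod (U $ l $ j))\<^sup>2) = 1"
        by (simp add: complex_norm_square mult.commute del: of_real_power)
      then have "(\<Sum>l\<in>UNIV. (cmod (U $ l $ j))\<^sup>2) = 1"
        by (simp only: of_real_eq_1_iff)
      then have "(cmod (U $ i $ j))\<^sup>2 \<le> 1"
        using member_le_sum[of i UNIV "\<lambda>l. (cmod (U $ l $ j))\<^sup>2"] by simp
      then show ?thesis
        by (simp add: power_le_one_iff)
    qed
    then have "norm (U $ i) \<le> (\<Sum>j\<in>(UNIV :: 'n set). 1)" for i
      unfolding norm_vec_def[of "U $ i"]
      by (intro order_trans[OF L2_set_le_sum] sum_mono) auto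
    then show ?thesis
      unfolding norm_vec_def[of U]
      by (intro order_trans[OF L2_set_le_sum] sum_mono) auto
  qed
  then have "bounded {U :: complex^'n^'n. adj U ** U = mat 1}"
    unfolding bounded_iff by blast
  ultimately show ?thesis
    unfolding eq by (simp add: compact_eq_bounded_closed)
qed

lemma tendsto_adj:
  assumes "(X \<longlongrightarrow> L) F"
  shows "((\<lambda>t. adj (X t)) \<longlongrightarrow> adj L) F"
  unfolding adj_def by (intro vec_tendstoI) (auto intro!: tendsto_intros assms)

lemma tendsto_matrix_mult:
  fixes X :: "'a \<Rightarrow> complex^'n^'m" and Y :: "'a \<Rightarrow> complex^'k^'n"
  assumes "(X \<longlongrightarrow> L) F" "(Y \<longlongrightarrow> M) F"
  shows "((\<lambda>t. X t ** Y t) \<longlongrightarrow> L ** M) F"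
  unfolding matrix_matrix_mult_def
  by (intro vec_tendstoI) (auto intro!: tendsto_intros assms)

lemma tendsto_diag:
  assumes "\<And>i. ((\<lambda>t. d t i) \<longlongrightarrow> e i) F"
  shows "((\<lambda>t. diag (d t)) \<longlongrightarrow> diag e) F"
  unfolding diag_def by (intro vec_tendstoI) (auto intro!: tendsto_intros assms)

text \<open>The hypothesis on \<open>\<phi>\<close> is continuous convergence to \<open>\<psi>\<close>. Diagonalizations of \<open>X t\<close> need not
  converge. If \<open>mat_fun (\<phi> t) (X t)\<close> did not tend to the claimed limit, the unitary factors would, by
  compactness, have a cluster point along those \<open>t\<close> for which it stays away from that limit. Along a finer filter the
  unitary factors converge, then so do the eigenvalues, and the limits diagonalize \<open>L\<close>.\<close>

lemma tendsto_mat_fun: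
  fixes X :: "'t \<Rightarrow> complex^'n^'n"
  assumes herm: "\<And>t. hermitian (X t)" and X: "(X \<longlongrightarrow> L) F"
    and \<phi>: "\<And>x. ((\<lambda>z. \<phi> (fst z) (snd z)) \<longlongrightarrow> \<psi> x) (F \<times>\<^sub>F nhds x)"
  shows "((\<lambda>t. mat_fun (\<phi> t) (X t)) \<longlongrightarrow> mat_fun \<psi> L) F"
proof (rule ccontr)
  assume "\<not> ?thesis"
  then obtain N where N: "open N" "mat_fun \<psi> L \<in> N"
      and "\<not> (\<forall>\<^sub>F t in F. mat_fun (\<phi> t) (X t) \<in> N)"
    by (auto simp: tendsto_def)
  then have freq: "\<exists>\<^sub>F t in F. mat_fun (\<phi> t) (X t) \<notin> N"
    by (simp add: frequently_def)
  have "\<exists>U d. unitary U \<and> X t = U ** diag d ** adj U" for t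
    using hermitian_diagonalization[OF herm] by metis
  then obtain U d where U: "\<And>t. unitary (U t)" and Xd: "\<And>t. X t = U t ** diag (d t) ** adj (U t)"
    by metis
  \<comment> \<open>\<open>G\<close> follows the \<open>t\<close> outside \<open>N\<close>; \<open>H\<close> refines it so that the unitary factors converge.\<close>
  define G where "G = inf F (principal {t. mat_fun (\<phi> t) (X t) \<notin> N})"
  have "G \<noteq> bot"
    using freq unfolding G_def trivial_limit_def eventually_inf_principal frequently_def by simp
  then have "filtermap U G \<noteq> bot"
    by (simp add: filtermap_bot_iff)
  moreover have "\<forall>\<^sub>F V in filtermap U G. V \<in> {V. unitary V}"
    by (simp add: eventually_filtermap U)
  ultimately obtain W where W: "unitary W" and "inf (nhds W) (filtermap U G) \<noteq> bot"
    using compact_unitary unfolding compact_filter by blast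
  define H where "H = inf G (filtercomap U (nhds W))"
  have H: "H \<noteq> bot"
  proof
    assume "H = bot"
    then obtain P Q where "eventually P G" "eventually Q (nhds W)" and PQ: "\<And>t. P t \<Longrightarrow> Q (U t) \<Longrightarrow> False"
      unfolding H_def trivial_limit_def eventually_inf eventually_filtercomap by blast
    then have "eventually (\<lambda>V. \<not> Q V) (filtermap U G)"
      unfolding eventually_filtermap by (metis (mono_tags, lifting) eventually_mono)
    then have "eventually (\<lambda>_. False) (inf (nhds W) (filtermap U G))"
      using \<open>eventually Q (nhds W)\<close> unfolding eventually_inf by blast
    then show False
      using \<open>inf (nhds W) (filtermap U G) \<noteq> bot\<close> by (simp add: trivial_limit_def)
  qed
  have HG: "H \<le> G" and HF: "H \<le> F"
    by (auto simp: H_def G_def intro: le_infI1)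
  have UW: "(U \<longlongrightarrow> W) H"
    unfolding H_def by (rule filterlim_mono[OF filterlim_filtercomap]) auto
  have XL: "(X \<longlongrightarrow> L) H"
    by (rule tendsto_mono[OF HF X])
  define e where "e i = Re ((adj W ** L ** W) $ i $ i)" for i
  have "adj (U t) ** X t ** U t = (adj (U t) ** U t) ** diag (d t) ** (adj (U t) ** U t)" for t
    by (simp add: Xd matrix_mul_assoc)
  then have diag_d: "diag (d t) = adj (U t) ** X t ** U t" for t
    using U[of t] by (simp add: unitaryD)
  have lim: "((\<lambda>t. diag (d t)) \<longlongrightarrow> adj W ** L ** W) H"
    unfolding diag_d by (intro tendsto_matrix_mult tendsto_adj UW XL)
  have d: "((\<lambda>t. d t i) \<longlongrightarrow> e i) H" for i
  proof -
    have "((\<lambda>t. Re (diag (d t) $ i $ i)) \<longlongrightarrow> e i) H"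
      unfolding e_def by (intro tendsto_intros lim)
    then show ?thesis
      by (simp add: diag_def)
  qed
  have "adj W ** L ** W = diag e"
    by (rule tendsto_unique[OF H lim tendsto_diag[OF d]])
  then have "W ** (adj W ** L ** W) ** adj W = W ** diag e ** adj W"
    by simp
  then have "(W ** adj W) ** L ** (W ** adj W) = W ** diag e ** adj W"
    by (simp add: matrix_mul_assoc)
  then have L: "L = W ** diag e ** adj W"
    using W by (simp add: unitaryD)
  have "((\<lambda>t. \<phi> t (d t i)) \<longlongrightarrow> \<psi> (e i)) H" for i
  proof -
    have "filterlim (\<lambda>t. (t, d t i)) (F \<times>\<^sub>F nhds (e i)) H"
      by (intro filterlim_Pair d) (use HF in \<open>simp add: filterlim_def\<close>)
    from filterlim_compose[OF \<phi> this] show ?thesis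
      by simp
  qed
  then have "((\<lambda>t. U t ** diag (\<phi> t \<circ> d t) ** adj (U t)) \<longlongrightarrow> W ** diag (\<psi> \<circ> e) ** adj W) H"
    by (intro tendsto_matrix_mult tendsto_adj UW tendsto_diag) simp
  then have "((\<lambda>t. mat_fun (\<phi> t) (X t)) \<longlongrightarrow> mat_fun \<psi> L) H"
    by (simp only: mat_fun_eq[OF U Xd] mat_fun_eq[OF W L])
  then have "\<forall>\<^sub>F t in H. mat_fun (\<phi> t) (X t) \<in> N"
    using N by (rule topological_tendstoD)
  moreover have "\<forall>\<^sub>F t in H. mat_fun (\<phi> t) (X t) \<notin> N"
    using HG unfolding G_def le_inf_iff le_principal by simp
  ultimately have "\<forall>\<^sub>F t in H. False"
    by eventually_elim simp
  then show False
    using H by (simp add: trivial_limit_def)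
qed

lemma one_plus_powr_tendsto_exp:
  "((\<lambda>z. (1 + fst z * snd z) powr (1 / fst z)) \<longlongrightarrow> exp x) (at_right 0 \<times>\<^sub>F nhds (x::real))"
proof -
  let ?F = "at_right (0::real) \<times>\<^sub>F nhds x"
  have p: "(fst \<longlongrightarrow> (0::real)) ?F" and pos: "\<forall>\<^sub>F z in ?F. 0 < fst z"
    using filterlim_fst[of "at_right (0::real)" "nhds x"] by (simp_all add: filterlim_at eventually_conj_iff)
  have s: "(snd \<longlongrightarrow> x) ?F"
    by (rule filterlim_snd)
  have ps: "((\<lambda>z. fst z * snd z) \<longlongrightarrow> 0) ?F"
    using tendsto_mult[OF p s] by simp
  have small: "\<forall>\<^sub>F z in ?F. \<bar>fst z * snd z\<bar> < 1 / 2"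
    using tendstoD[OF ps, of "1 / 2"] by (simp add: dist_real_def)
  have "((\<lambda>z. ln (1 + fst z * snd z) / fst z - snd z) \<longlongrightarrow> 0) ?F"
  proof (rule Lim_null_comparison)
    show "\<forall>\<^sub>F z in ?F. norm (ln (1 + fst z * snd z) / fst z - snd z) \<le> 2 * fst z * (snd z)\<^sup>2"
      using pos small
    proof eventually_elim
      case (elim z)
      then have "\<bar>ln (1 + fst z * snd z) - fst z * snd z\<bar> \<le> 2 * (fst z * snd z)\<^sup>2"
        by (intro abs_ln_one_plus_x_minus_x_bound) simp
      moreover have "ln (1 + fst z * snd z) / fst z - snd z
          = (ln (1 + fst z * snd z) - fst z * snd z) / fst z"
        using elim by (simp add: field_simps)
      ultimately show ?case
        using elim by (simp add: abs_divide divide_le_eq power2_eq_square mult_ac)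
    qed
    have "((\<lambda>z. 2 * fst z * (snd z)\<^sup>2) \<longlongrightarrow> 2 * 0 * x\<^sup>2) ?F"
      by (intro tendsto_intros p s)
    then show "((\<lambda>z. 2 * fst z * (snd z)\<^sup>2) \<longlongrightarrow> 0) ?F"
      by simp
  qed
  from tendsto_exp[OF tendsto_add[OF this s]]
  have "((\<lambda>z. exp (ln (1 + fst z * snd z) / fst z)) \<longlongrightarrow> exp x) ?F"
    by simp
  moreover have "\<forall>\<^sub>F z in ?F. exp (ln (1 + fst z * snd z) / fst z) = (1 + fst z * snd z) powr (1 / fst z)"
    using small by eventually_elim (auto simp: powr_def)
  ultimately show ?thesis
    by (rule Lim_transform_eventually)
qed

lemma powr_diff_quotient_tendsto_ln:
  assumes "0 < (x::real)"
  shows "((\<lambda>p. (x powr p - 1) / p) \<longlongrightarrow> ln x) (at_right 0)"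
proof -
  have "((\<lambda>p. x powr p) has_real_derivative ln x) (at 0)"
    using assms by (auto intro!: derivative_eq_intros)
  then have "((\<lambda>p. (x powr p - 1) / p) \<longlongrightarrow> ln x) (at 0)"
    using assms by (simp add: has_field_derivative_iff)
  then show ?thesis
    by (rule tendsto_within_subset) simp
qed

lemma matrix_mult_add_left:
  fixes A B :: "complex^'n^'m" and C :: "complex^'k^'n"
  shows "(A + B) ** C = A ** C + B ** C"
  by (simp add: matrix_matrix_mult_def vec_eq_iff distrib_right sum.distrib)

lemma matrix_mult_scaleR:
  fixes X :: "complex^'n^'m" and Y :: "complex^'k^'n"
  shows "X ** (c *\<^sub>R Y) = c *\<^sub>R (X ** Y)"
  by (simp add: matrix_matrix_mult_def vec_eq_iff scaleR_sum_right)

lemma scaleR_mult_matrix: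
  fixes X :: "complex^'n^'m" and Y :: "complex^'k^'n"
  shows "(c *\<^sub>R X) ** Y = c *\<^sub>R (X ** Y)"
  by (simp add: matrix_matrix_mult_def vec_eq_iff scaleR_sum_right)

text \<open>With \<open>K p\<close> the mean of the difference quotients \<open>(A\<^sup>p - 1) / p\<close> and \<open>(B\<^sup>p - 1) / p\<close>, the power mean
  is \<open>(1 + p K p)\<close> to the power \<open>1 / p\<close>, and \<open>K p\<close> tends to \<open>(log A + log B) / 2\<close>.\<close>

lemma power_mean_tendsto_exp_mean_ln:
  fixes U W :: "complex^'n^'n"
  assumes U: "unitary U" and A: "A = U ** diag a ** adj U" and a: "\<And>i. 0 < a i"
    and W: "unitary W" and B: "B = W ** diag b ** adj W" and b: "\<And>i. 0 < b i"
  shows "((\<lambda>p. power_mean p A B) \<longlongrightarrow> mat_fun exp ((1 / 2) *\<^sub>R (mat_fun ln A + mat_fun ln B)))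
           (at_right 0)"
proof -
  define q :: "real \<Rightarrow> real \<Rightarrow> real" where "q p x = (x powr p - 1) / p" for p x
  define K where "K p = (1 / 2 :: real) *\<^sub>R (mat_fun (q p) A + mat_fun (q p) B)" for p
  have herm: "hermitian (K p)" for p
    unfolding K_def mat_fun_eq[OF U A] mat_fun_eq[OF W B]
    by (intro hermitian_midpoint hermitian_unitary_diag)
  have "(K \<longlongrightarrow> (1 / 2) *\<^sub>R (mat_fun ln A + mat_fun ln B)) (at_right 0)"
    unfolding K_def mat_fun_eq[OF U A] mat_fun_eq[OF W B] q_def
    by (intro tendsto_intros tendsto_matrix_mult tendsto_diag)
       (auto simp: o_def intro: powr_diff_quotient_tendsto_ln a b)
  then have lim: "((\<lambda>p. mat_fun (\<lambda>x. (1 + p * x) powr (1 / p)) (K p)) \<longlongrightarrow>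
      mat_fun exp ((1 / 2) *\<^sub>R (mat_fun ln A + mat_fun ln B))) (at_right 0)"
    by (rule tendsto_mat_fun[OF herm]) (rule one_plus_powr_tendsto_exp)
  have "mat_fun (\<lambda>x. (1 + p * x) powr (1 / p)) (K p) = power_mean p A B" if p: "0 < p" for p
  proof -
    have affine: "V ** diag (\<lambda>i. 1 + p * k i) ** adj V = mat 1 + p *\<^sub>R (V ** diag k ** adj V)"
      if V: "unitary V" for V :: "complex^'n^'n" and k
    proof -
      have "diag (\<lambda>i. 1 + p * k i) = mat 1 + p *\<^sub>R (diag k :: complex^'n^'n)"
        by (simp add: diag_def mat_def vec_eq_iff scaleR_conv_of_real[where 'a = complex])
      then show ?thesis
        using V by (simp add: matrix_add_ldistrib matrix_mult_add_left scaleR_mult_matrix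
            matrix_mult_scaleR unitaryD)
    qed
    have powr: "mat_fun (\<lambda>x. x powr p) C = mat 1 + p *\<^sub>R mat_fun (q p) C"
      if V: "unitary V" and C: "C = V ** diag c ** adj V" for V C :: "complex^'n^'n" and c
    proof -
      have "(\<lambda>x. x powr p) \<circ> c = (\<lambda>i. 1 + p * (q p \<circ> c) i)"
        using p by (simp add: q_def fun_eq_iff)
      then show ?thesis
        unfolding mat_fun_eq[OF V C] using affine[OF V, of "q p \<circ> c"] by simp
    qed
    have mid: "(1 / 2 :: real) *\<^sub>R (mat_fun (\<lambda>x. x powr p) A + mat_fun (\<lambda>x. x powr p) B)
        = mat 1 + p *\<^sub>R K p"
      unfolding powr[OF U A] powr[OF W B] K_def
      by (simp add: vec_eq_iff) (simp add: scaleR_conv_of_real field_simps)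
    obtain V k where V: "unitary V" and K: "K p = V ** diag k ** adj V"
      using hermitian_diagonalization[OF herm] by blast
    have "mat 1 + p *\<^sub>R K p = V ** diag (\<lambda>i. 1 + p * k i) ** adj V"
      by (simp add: affine[OF V] K)
    from mat_fun_eq[OF V this] show ?thesis
      unfolding power_mean_def mid mat_fun_eq[OF V K] by (simp add: o_def)
  qed
  then have "\<forall>\<^sub>F p in at_right 0. mat_fun (\<lambda>x. (1 + p * x) powr (1 / p)) (K p) = power_mean p A B"
    by (intro eventually_at_rightI[of 0 1]) auto
  with lim show ?thesis
    by (rule Lim_transform_eventually)
qed

lemma power_mean0_eq_exp_mean_ln:
  fixes U W :: "complex^'n^'n"
  assumes "unitary U" "A = U ** diag a ** adj U" "\<And>i. 0 < a i"
    and "unitary W" "B = W ** diag b ** adj W" "\<And>i. 0 < b i"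
  shows "power_mean0 A B = mat_fun exp ((1 / 2) *\<^sub>R (mat_fun ln A + mat_fun ln B))"
  unfolding power_mean0_def
  using power_mean_tendsto_exp_mean_ln[OF assms] by (intro tendsto_Lim) auto

section \<open>Mean inequalities for doubly concave functions\<close>

lemma inner_midpoint_mat_fun_le:
  fixes U W :: "complex^'n^'n"
  assumes U: "unitary U" and A: "A = U ** diag a ** adj U"
    and W: "unitary W" and B: "B = W ** diag b ** adj W"
    and le: "\<And>s. s \<in> range a \<union> range b \<Longrightarrow> g s \<le> c + m * u s"
  shows "x \<bullet> (((1 / 2 :: real) *\<^sub>R (mat_fun g A + mat_fun g B)) *v x)
    \<le> c * (x \<bullet> x) + m * (x \<bullet> (((1 / 2 :: real) *\<^sub>R (mat_fun u A + mat_fun u B)) *v x))"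
proof -
  have one: "x \<bullet> (mat_fun g C *v x) \<le> c * (x \<bullet> x) + m * (x \<bullet> (mat_fun u C *v x))"
    if V: "unitary V" and C: "C = V ** diag k ** adj V" and k: "range k \<subseteq> range a \<union> range b"
    for V C :: "complex^'n^'n" and k
  proof -
    have "x \<bullet> (mat_fun g C *v x) \<le> (\<Sum>i\<in>UNIV. (c + m * u (k i)) * (cmod ((adj V *v x) $ i))\<^sup>2)"
      unfolding mat_fun_eq[OF V C] inner_diag_mult_vec
    proof (intro sum_mono mult_right_mono)
      fix i
      have "k i \<in> range a \<union> range b"
        using k by blast
      then show "(g \<circ> k) i \<le> c + m * u (k i)"
        using le by simp
    qed simp
    also have "\<dots> = c * (x \<bullet> x) + m * (x \<bullet> (mat_fun u C *v x))"
      unfolding mat_fun_eq[OF V C] inner_diag_mult_vec inner_self_unitary[OF V, of x]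
      by (simp add: distrib_right sum.distrib sum_distrib_left mult.assoc)
    finally show ?thesis .
  qed
  show ?thesis
    using one[OF U A] one[OF W B] unfolding inner_midpoint_mult_vec by (simp add: algebra_simps add_divide_distrib)
qed

text \<open>Supporting lines of \<open>g\<close> as a function of \<open>u\<close>, taken at the eigenvalues \<open>k j\<close> of the mean of \<open>u(A)\<close>
  and \<open>u(B)\<close>, bound the eigenvalues of the mean of \<open>g(A)\<close> and \<open>g(B)\<close>. Here \<open>G\<close> is \<open>g\<close> expressed
  through \<open>u\<close>, so \<open>G (u x) = g x\<close> on the spectra in the applications, and \<open>r\<close> provides slack where no line
  touches the graph of \<open>G\<close> itself.\<close>

lemma mean_eigenvalues_dominated:
  fixes U W V Z :: "complex^'n^'n"
  assumes U: "unitary U" and A: "A = U ** diag a ** adj U"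
    and W: "unitary W" and B: "B = W ** diag b ** adj W"
    and V: "unitary V" and H: "(1 / 2) *\<^sub>R (mat_fun g A + mat_fun g B) = V ** diag h ** adj V"
    and Z: "unitary Z" and K: "(1 / 2) *\<^sub>R (mat_fun u A + mat_fun u B) = Z ** diag k ** adj Z"
    and support: "\<And>j r. G (k j) < r \<Longrightarrow> \<exists>c m. 0 \<le> m \<and> c + m * k j \<le> r \<and>
        (\<forall>s \<in> range a \<union> range b. g s \<le> c + m * u s)"
  obtains \<sigma> where "bij \<sigma>" "\<And>i. h i \<le> G (k (\<sigma> i))"
proof -
  have "\<exists>c m. 0 \<le> m \<and> c + m * k j \<le> r \<and> (\<forall>x. x \<bullet> ((V ** diag h ** adj V) *v x)
          \<le> c * (x \<bullet> x) + m * (x \<bullet> ((Z ** diag k ** adj Z) *v x)))" if r: "G (k j) < r" for j r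
  proof -
    obtain c m where "0 \<le> m" "c + m * k j \<le> r" "\<And>s. s \<in> range a \<union> range b \<Longrightarrow> g s \<le> c + m * u s"
      using support[OF r] by blast
    then show ?thesis
      using inner_midpoint_mat_fun_le[OF U A W B, of g c m u] unfolding H K by blast
  qed
  from eigenvalues_dominated[OF V Z, of "\<lambda>j. G (k j)" k h, OF this] show thesis
    using that by blast
qed

lemma doubly_concave_power_mean_le:
  fixes A B :: "complex^'n^'n"
  assumes f: "doubly_concave_on {0..} f" and "psd A" "psd B" and p: "0 < p"
  shows "\<exists>V. unitary V \<and> V ** power_mean p (mat_fun f A) (mat_fun f B) ** adj V
           \<preceq> mat_fun f (power_mean p A B)"
proof -
  note fD = doubly_concave_onD[OF f]
  obtain U a where U: "unitary U" and A: "A = U ** diag a ** adj U" and a: "\<And>i. 0 \<le> a i"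
    using psd_diagonalization[OF \<open>psd A\<close>] by blast
  obtain W b where W: "unitary W" and B: "B = W ** diag b ** adj W" and b: "\<And>i. 0 \<le> b i"
    using psd_diagonalization[OF \<open>psd B\<close>] by blast
  define u where "u x = x powr p" for x :: real
  define g where "g x = f x powr p" for x
  define M where "M \<phi> = (1 / 2 :: real) *\<^sub>R (mat_fun \<phi> A + mat_fun \<phi> B)" for \<phi>
  have M_psd: "psd (M \<phi>)" if "\<And>x. 0 \<le> \<phi> x" for \<phi>
  proof -
    have "psd (mat_fun \<phi> A)" "psd (mat_fun \<phi> B)"
      unfolding mat_fun_eq[OF U A] mat_fun_eq[OF W B] by (simp_all add: psd_unitary_diag that)
    then show ?thesis
      unfolding M_def by (rule psd_midpoint)
  qed
  obtain V h where V: "unitary V" and H: "M g = V ** diag h ** adj V" and h: "\<And>i. 0 \<le> h i"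
    using psd_diagonalization[OF M_psd[of g]] by (auto simp: g_def)
  obtain Z k where Z: "unitary Z" and K: "M u = Z ** diag k ** adj Z" and k: "\<And>i. 0 \<le> k i"
    using psd_diagonalization[OF M_psd[of u]] by (auto simp: u_def)
  have support: "\<exists>c m. 0 \<le> m \<and> c + m * k j \<le> r \<and> (\<forall>s \<in> range a \<union> range b. g s \<le> c + m * u s)"
    if r: "f (k j powr (1 / p)) powr p < r" for j r
  proof -
    have kj: "(k j powr (1 / p)) powr p = k j"
      using p k[of j] by (simp add: powr_powr)
    obtain c m where cm: "0 \<le> m" "c + m * k j \<le> r"
      and le: "\<And>x. 0 \<le> x \<Longrightarrow> f x powr p \<le> c + m * x powr p"
      using doubly_concave_powr_le_affine[OF f p powr_ge_zero r] unfolding kj by metis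
    have "\<forall>s \<in> range a \<union> range b. g s \<le> c + m * u s"
      using a b by (auto simp: g_def u_def intro: le)
    with cm show ?thesis
      by blast
  qed
  obtain \<sigma> where \<sigma>: "bij \<sigma>" and dom: "\<And>i. h i \<le> f (k (\<sigma> i) powr (1 / p)) powr p"
    using mean_eigenvalues_dominated[OF U A W B V H[unfolded M_def] Z K[unfolded M_def],
        of "\<lambda>t. f (t powr (1 / p)) powr p", OF support] by blast
  have le: "h i powr (1 / p) \<le> f (k (\<sigma> i) powr (1 / p))" for i
  proof -
    have "h i powr (1 / p) \<le> (f (k (\<sigma> i) powr (1 / p)) powr p) powr (1 / p)"
      using p by (intro powr_mono2 h dom) simp
    also have "\<dots> = f (k (\<sigma> i) powr (1 / p))"
      using p fD(1) by (simp add: powr_powr)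
    finally show ?thesis .
  qed
  have "mat_fun (\<lambda>x. x powr p) (mat_fun f A) = mat_fun g A"
    "mat_fun (\<lambda>x. x powr p) (mat_fun f B) = mat_fun g B"
    unfolding A B mat_fun_comp[OF U] mat_fun_comp[OF W] by (simp_all add: g_def[abs_def] o_def)
  then have "power_mean p (mat_fun f A) (mat_fun f B) = mat_fun (\<lambda>x. x powr (1 / p)) (M g)"
    by (simp add: power_mean_def M_def)
  then have lhs: "power_mean p (mat_fun f A) (mat_fun f B) = V ** diag (\<lambda>i. h i powr (1 / p)) ** adj V"
    by (simp add: mat_fun_eq[OF V H] o_def)
  have "power_mean p A B = mat_fun (\<lambda>x. x powr (1 / p)) (M u)"
    by (simp add: power_mean_def M_def u_def[abs_def])
  then have "mat_fun f (power_mean p A B) = mat_fun (f \<circ> (\<lambda>x. x powr (1 / p))) (M u)"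
    by (simp add: K mat_fun_comp[OF Z])
  then have rhs: "mat_fun f (power_mean p A B) = Z ** diag (\<lambda>j. f (k j powr (1 / p))) ** adj Z"
    by (simp add: mat_fun_eq[OF Z K] o_def)
  show ?thesis
    unfolding lhs rhs by (rule loewner_le_of_permuted_eigenvalues[OF V Z \<sigma>]) (rule le)
qed

lemma doubly_concave_power_mean0_le:
  fixes A B :: "complex^'n^'n"
  assumes f: "doubly_concave_on {0..} f" and "psd A" "psd B"
    and nonzero: "0 \<le> z" "f z \<noteq> 0" and "invertible A" "invertible B"
  shows "\<exists>V. unitary V \<and> V ** power_mean0 (mat_fun f A) (mat_fun f B) ** adj V
           \<preceq> mat_fun f (power_mean0 A B)"
proof -
  have pos: "0 < f x" if "0 < x" for x
    by (rule doubly_concave_pos[OF f nonzero that])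
  obtain U a where U: "unitary U" and A: "A = U ** diag a ** adj U" and a: "\<And>i. 0 < a i"
    using pos_def_diagonalization[OF \<open>psd A\<close> \<open>invertible A\<close>] by blast
  obtain W b where W: "unitary W" and B: "B = W ** diag b ** adj W" and b: "\<And>i. 0 < b i"
    using pos_def_diagonalization[OF \<open>psd B\<close> \<open>invertible B\<close>] by blast
  define g where "g x = ln (f x)" for x
  define M where "M \<phi> = (1 / 2 :: real) *\<^sub>R (mat_fun \<phi> A + mat_fun \<phi> B)" for \<phi>
  have M_herm: "hermitian (M \<phi>)" for \<phi>
    unfolding M_def mat_fun_eq[OF U A] mat_fun_eq[OF W B]
    by (intro hermitian_midpoint hermitian_unitary_diag)
  obtain V h where V: "unitary V" and H: "M g = V ** diag h ** adj V"
    using hermitian_diagonalization[OF M_herm] by blast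
  obtain Z k where Z: "unitary Z" and K: "M ln = Z ** diag k ** adj Z"
    using hermitian_diagonalization[OF M_herm] by blast
  have support: "\<exists>c m. 0 \<le> m \<and> c + m * k j \<le> r \<and> (\<forall>s \<in> range a \<union> range b. g s \<le> c + m * ln s)"
    if r: "ln (f (exp (k j))) < r" for j r
  proof -
    obtain \<theta> where \<theta>: "0 \<le> \<theta>"
      and le: "\<And>s. ln (f (exp s)) \<le> ln (f (exp (k j))) + \<theta> * (s - k j)"
      using doubly_concave_exponent[OF f pos, of "k j"] by blast
    have "g s \<le> (ln (f (exp (k j))) - \<theta> * k j) + \<theta> * ln s" if "s \<in> range a \<union> range b" for s
    proof -
      have "0 < s" using that a b by auto
      then show ?thesis
        using le[of "ln s"] by (simp add: g_def algebra_simps)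
    qed
    moreover have "(ln (f (exp (k j))) - \<theta> * k j) + \<theta> * k j \<le> r"
      using r by simp
    ultimately show ?thesis
      using \<theta> by blast
  qed
  obtain \<sigma> where \<sigma>: "bij \<sigma>" and dom: "\<And>i. h i \<le> ln (f (exp (k (\<sigma> i))))"
    using mean_eigenvalues_dominated[OF U A W B V H[unfolded M_def] Z K[unfolded M_def],
        of "\<lambda>t. ln (f (exp t))", OF support] by blast
  have le: "exp (h i) \<le> f (exp (k (\<sigma> i)))" for i
    using dom[of i] pos[of "exp (k (\<sigma> i))"] by (simp add: ln_ge_iff)
  have fA: "mat_fun f A = U ** diag (f \<circ> a) ** adj U" and fB: "mat_fun f B = W ** diag (f \<circ> b) ** adj W"
    by (rule mat_fun_eq[OF U A], rule mat_fun_eq[OF W B])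
  have "mat_fun ln (mat_fun f A) = mat_fun g A" "mat_fun ln (mat_fun f B) = mat_fun g B"
    unfolding A B mat_fun_comp[OF U] mat_fun_comp[OF W] by (simp_all add: g_def[abs_def] o_def)
  then have "power_mean0 (mat_fun f A) (mat_fun f B) = mat_fun exp (M g)"
    using power_mean0_eq_exp_mean_ln[OF U fA _ W fB] a b pos by (simp add: M_def)
  then have lhs: "power_mean0 (mat_fun f A) (mat_fun f B) = V ** diag (\<lambda>i. exp (h i)) ** adj V"
    by (simp add: mat_fun_eq[OF V H] o_def)
  have "power_mean0 A B = mat_fun exp (M ln)"
    unfolding M_def by (rule power_mean0_eq_exp_mean_ln[OF U A a W B b])
  then have "mat_fun f (power_mean0 A B) = mat_fun (f \<circ> exp) (M ln)"
    by (simp add: K mat_fun_comp[OF Z])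
  then have rhs: "mat_fun f (power_mean0 A B) = Z ** diag (\<lambda>j. f (exp (k j))) ** adj Z"
    by (simp add: mat_fun_eq[OF Z K] o_def)
  show ?thesis
    unfolding lhs rhs by (rule loewner_le_of_permuted_eigenvalues[OF V Z \<sigma>]) (rule le)
qed

theorem corollary2p8:
  fixes f :: "real \<Rightarrow> real" and A B :: "complex^'n^'n"
  assumes "doubly_concave_on {0..} f" and "psd A" and "psd B"
  shows "(\<forall>p. 0 < p \<and> p \<le> 1 \<longrightarrow>
            (\<exists>V. unitary V \<and>
               V ** power_mean p (mat_fun f A) (mat_fun f B) ** adj V
                 \<preceq> mat_fun f (power_mean p A B))) \<and>
         ((\<exists>x\<in>{0..}. f x \<noteq> 0) \<and> invertible A \<and> invertible B \<longrightarrow>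
            (\<exists>V. unitary V \<and>
               V ** power_mean0 (mat_fun f A) (mat_fun f B) ** adj V
                 \<preceq> mat_fun f (power_mean0 A B)))"
  using doubly_concave_power_mean_le[OF assms] doubly_concave_power_mean0_le[OF assms] by auto

end
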